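(* Let $n\ge 2$ and let $K\subset\mathbb{R}^n$ be a bounded convex open set. Suppose that the Hilbert metric of $K$ is a Berwald metric, i.e. the Hilbert fundamental function $F_K$ is a Finsler fundamental function on $K$ and $(K,F_K)$ is of Berwald type. Then $F_K$ is Riemannian (that is, for each $x\in K$, $F_K(x,\cdot)^2$ is a positive definite quadratic form on $T_xK$), and $K$ is an ellipsoid.
   Context: **Hilbert metric.** For a bounded convex open set $K\subset\mathbb{R}^n$ ($n\ge2$), the Hilbert metric $d_K$ is given by $d_K(x,x)=0$ and, for distinct $x,y\in K$, $$d_K(x,y)=\frac12\ln\left(\frac{\|y-a\|}{\|x-a\|}\cdot\frac{\|x-b\|}{\|y-b\|}\right),$$ where $a,b\in\partial K$ are the points where the line through $x,y$ meets $\partial K$, with order $a,x,y,b$ on the line, and $\|\cdot\|$ is the Euclidean norm. **Hilbert fundamental function.** For $p\in K$ and $0\ne u\in T_pK\cong\mathbb{R}^n$, the Funk metric $\widetilde F_K(p,u)>0$ is defined by the condition $p+\frac{1}{\widetilde F_K(p,u)}u\in\partial K$, and $\widetilde F_K(p,0)=0$. The Hilbert fundamental function is $$F_K(p,u)=\tfrac12\left(\widetilde F_K(p,u)+\widetilde F_K(p,-u)\right).$$ The distance induced by $F_K$ (the infimum of the lengths $\int F_K(\gamma,\dot\gamma)\,dt$ over piecewise $C^\infty$ curves joining two points) is $d_K$. **Finsler fundamental function.** Let $M$ be a $C^\infty$ manifold. A continuous function $F:TM\to[0,\infty)$ is a Finsler fundamental function if the following hold: - it is $C^\infty$ on $TM\setminus\{0\}$;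 - $F(tu)=tF(u)$ for all $t\ge0$ and $u\in TM$; - the matrix $g_{ij}(x,y)=\left(\tfrac12F^2\right)_{y^iy^j}(x,y)$ is positive definite for all $(x,y)\in TM\setminus\{0\}$. Here $x^i$ are local coordinates on $M$ and $(x^i,y^i)$ are the induced natural coordinates on $TM$. **Berwald type.** The Chern connection coefficients of $(M,F)$ in natural coordinates are $$\Gamma^i_{jk}(x,y)=\tfrac12 g^{il}\left(\frac{\delta g_{lk}}{\delta x^j}+\frac{\delta g_{jl}}{\delta x^k}-\frac{\delta g_{jk}}{\delta x^l}\right),\qquad \frac{\delta}{\delta x^j}=\frac{\partial}{\partial x^j}-N^m_j\frac{\partial}{\partial y^m},$$ where $N^m_j=\tfrac12\frac{\partial}{\partial y^j}\left(\gamma^m_{rs}y^ry^s\right)$ and $\gamma^m_{rs}=\tfrac12g^{ml}\left(\partial_{x^r}g_{ls}+\partial_{x^s}g_{rl}-\partial_{x^l}g_{rs}\right)$. The Finsler manifold $(M,F)$ is of Berwald type if the $\Gamma^i_{jk}$ in natural coordinates depend only on the base point $x$ and not on $y$. **Ellipsoid.** Since $K$ is open, "$K$ is an ellipsoid" means that $K$ is the image of the open Euclidean unit ball under an invertible affine map of $\mathbb{R}^n$. *)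

theory Defs
  imports "HOL-Analysis.Analysis"
begin

text \<open>
  \<open>Ck_on k f S\<close> is intended for open \<open>S\<close> only: derivatives are taken in the ambient space.
  By induction on \<open>k\<close> it says that \<open>f\<close> is \<open>k\<close> times continuously differentiable on \<open>S\<close>, since
  the Frechet derivative is continuous iff its value on every fixed direction \<open>v\<close> is.
\<close>

primrec Ck_on :: "nat \<Rightarrow> ('a::euclidean_space \<Rightarrow> 'b::euclidean_space) \<Rightarrow> 'a set \<Rightarrow> bool" where
  "Ck_on 0 f S \<longleftrightarrow> continuous_on S f"
| "Ck_on (Suc k) f S \<longleftrightarrow>
     (\<forall>x\<in>S. f differentiable (at x)) \<and>
     (\<forall>v. Ck_on k (\<lambda>x. frechet_derivative f (at x) v) S)"

definition smooth_on :: "('a::euclidean_space \<Rightarrow> 'b::euclidean_space) \<Rightarrow> 'a set \<Rightarrow> bool" where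
  "smooth_on f S \<longleftrightarrow> (\<forall>k. Ck_on k f S)"

text \<open>
  The manifold \<open>M\<close> is an open subset of \<open>real ^ 'n\<close> with its standard global chart, so that
  \<open>TM = M \<times> UNIV\<close> and the natural coordinates of a tangent vector \<open>y\<close> at \<open>x\<close> are the components
  of \<open>x\<close> and \<open>y\<close>. Functions on \<open>TM\<close> are curried; values at base points outside \<open>M\<close> are irrelevant.
\<close>

type_synonym 'n tfun = "real ^ 'n \<Rightarrow> real ^ 'n \<Rightarrow> real"

definition dx :: "'n::finite \<Rightarrow> 'n tfun \<Rightarrow> 'n tfun" where
  "dx i f x y = deriv (\<lambda>t. f (x + t *\<^sub>R axis i 1) y) 0"

definition dy :: "'n::finite \<Rightarrow> 'n tfun \<Rightarrow> 'n tfun" where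
  "dy i f x y = deriv (\<lambda>t. f x (y + t *\<^sub>R axis i 1)) 0"

definition positive_definite :: "real ^ 'n ^ 'n \<Rightarrow> bool" where
  "positive_definite A \<longleftrightarrow> transpose A = A \<and> (\<forall>v. v \<noteq> 0 \<longrightarrow> v \<bullet> (A *v v) > 0)"

definition fund_tensor :: "'n::finite tfun \<Rightarrow> 'n \<Rightarrow> 'n \<Rightarrow> 'n tfun" where
  "fund_tensor F i j = dy j (dy i (\<lambda>x y. (F x y)\<^sup>2 / 2))"

definition fund_matrix :: "'n::finite tfun \<Rightarrow> real ^ 'n \<Rightarrow> real ^ 'n \<Rightarrow> real ^ 'n ^ 'n" where
  "fund_matrix F x y = (\<chi> i j. fund_tensor F i j x y)"

definition fund_tensor_inv :: "'n::finite tfun \<Rightarrow> 'n \<Rightarrow> 'n \<Rightarrow> 'n tfun" where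
  "fund_tensor_inv F i j x y = matrix_inv (fund_matrix F x y) $ i $ j"

definition finsler_fundamental :: "(real ^ 'n) set \<Rightarrow> 'n::finite tfun \<Rightarrow> bool" where
  "finsler_fundamental M F \<longleftrightarrow>
     (\<forall>x\<in>M. \<forall>y. F x y \<ge> 0) \<and>
     continuous_on (M \<times> UNIV) (\<lambda>(x, y). F x y) \<and>
     smooth_on (\<lambda>(x, y). F x y) (M \<times> (UNIV - {0})) \<and>
     (\<forall>x\<in>M. \<forall>y. \<forall>t\<ge>0. F x (t *\<^sub>R y) = t * F x y) \<and>
     (\<forall>x\<in>M. \<forall>y. y \<noteq> 0 \<longrightarrow> positive_definite (fund_matrix F x y))"

text \<open>In the three-index symbols and in \<open>nonlinear_conn\<close> the upper index is the first argument.\<close>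

definition formal_christoffel :: "'n::finite tfun \<Rightarrow> 'n \<Rightarrow> 'n \<Rightarrow> 'n \<Rightarrow> 'n tfun" where
  "formal_christoffel F m r s x y =
     (1 / 2) * (\<Sum>l\<in>UNIV. fund_tensor_inv F m l x y *
       (dx r (fund_tensor F l s) x y + dx s (fund_tensor F r l) x y
          - dx l (fund_tensor F r s) x y))"

definition nonlinear_conn :: "'n::finite tfun \<Rightarrow> 'n \<Rightarrow> 'n \<Rightarrow> 'n tfun" where
  "nonlinear_conn F m j x y =
     (1 / 2) *
       dy j (\<lambda>x y. \<Sum>r\<in>UNIV. \<Sum>s\<in>UNIV. formal_christoffel F m r s x y * y $ r * y $ s) x y"

definition horiz_deriv :: "'n::finite tfun \<Rightarrow> 'n \<Rightarrow> 'n tfun \<Rightarrow> 'n tfun" where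
  "horiz_deriv F j h x y = dx j h x y - (\<Sum>m\<in>UNIV. nonlinear_conn F m j x y * dy m h x y)"

definition chern_coeff :: "'n::finite tfun \<Rightarrow> 'n \<Rightarrow> 'n \<Rightarrow> 'n \<Rightarrow> 'n tfun" where
  "chern_coeff F i j k x y =
     (1 / 2) * (\<Sum>l\<in>UNIV. fund_tensor_inv F i l x y *
       (horiz_deriv F j (fund_tensor F l k) x y + horiz_deriv F k (fund_tensor F j l) x y
          - horiz_deriv F l (fund_tensor F j k) x y))"

definition berwald_type :: "(real ^ 'n) set \<Rightarrow> 'n::finite tfun \<Rightarrow> bool" where
  "berwald_type M F \<longleftrightarrow>
     (\<forall>i j k. \<forall>x\<in>M. \<forall>y y'. y \<noteq> 0 \<longrightarrow> y' \<noteq> 0 \<longrightarrow>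
        chern_coeff F i j k x y = chern_coeff F i j k x y')"

definition riemannian :: "(real ^ 'n) set \<Rightarrow> 'n::finite tfun \<Rightarrow> bool" where
  "riemannian M F \<longleftrightarrow>
     (\<forall>x\<in>M. \<exists>A. positive_definite A \<and> (\<forall>u. (F x u)\<^sup>2 = u \<bullet> (A *v u)))"

definition funk :: "(real ^ 'n::finite) set \<Rightarrow> 'n tfun" where
  "funk K p u =
     (if u = 0 then 0 else (THE c. c > 0 \<and> p + (1 / c) *\<^sub>R u \<in> frontier K))"

lemma funk_well_defined:
  fixes K :: "(real ^ 'n::finite) set"
  assumes K: "open K" "bounded K" "convex K" and p: "p \<in> K" and u: "u \<noteq> 0"
  shows "\<exists>!c. c > 0 \<and> p + (1 / c) *\<^sub>R u \<in> frontier K"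
proof -
  have pint: "p \<in> interior K"
    using K p by (simp add: interior_open)
  obtain d where d: "d > 0" "p + d *\<^sub>R u \<in> frontier K"
    and dint: "\<And>e. 0 \<le> e \<Longrightarrow> e < d \<Longrightarrow> p + e *\<^sub>R u \<in> interior K"
    using ray_to_frontier[OF K(2) pint u] by metis
  have uniq: "e = d" if e: "e > 0" "p + e *\<^sub>R u \<in> frontier K" for e
  proof (rule ccontr)
    assume "e \<noteq> d"
    then consider "e < d" | "d < e" by linarith
    then show False
    proof cases
      case 1
      then show False using dint[of e] e by (auto simp: frontier_def)
    next
      case 2
      have "p + d *\<^sub>R u = (1 - d / e) *\<^sub>R p + (d / e) *\<^sub>R (p + e *\<^sub>R u)"
        using e by (simp add: algebra_simps)
      moreover have "p \<noteq> p + e *\<^sub>R u" using e u by simp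
      ultimately have "p + d *\<^sub>R u \<in> open_segment p (p + e *\<^sub>R u)"
        unfolding in_segment using 2 d e by (intro conjI exI[of _ "d / e"]) auto
      moreover have "p + e *\<^sub>R u \<in> closure K"
        using e by (simp add: frontier_def)
      ultimately have "p + d *\<^sub>R u \<in> interior K"
        using in_interior_closure_convex_segment[OF K(3) pint] by blast
      then show False using d by (simp add: frontier_def)
    qed
  qed
  show ?thesis
  proof (rule ex1I[of _ "1 / d"])
    show "1 / d > 0 \<and> p + (1 / (1 / d)) *\<^sub>R u \<in> frontier K" using d by simp
  next
    fix c assume "c > 0 \<and> p + (1 / c) *\<^sub>R u \<in> frontier K"
    then show "c = 1 / d" using uniq[of "1 / c"] by auto
  qed
qed

definition hilbert_fundamental :: "(real ^ 'n::finite) set \<Rightarrow> 'n tfun" where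
  "hilbert_fundamental K p u = (funk K p u + funk K p (- u)) / 2"

definition ellipsoid :: "(real ^ 'n::finite) set \<Rightarrow> bool" where
  "ellipsoid K \<longleftrightarrow>
     (\<exists>(A :: real ^ 'n ^ 'n) b. invertible A \<and> K = (\<lambda>x. A *v x + b) ` ball 0 1)"

end

theory Submission
  imports Defs
begin

text \<open>
  Let \<open>\<theta>(x, y)\<close> be the Funk metric of \<open>K\<close>, let \<open>\<theta>'(x, y) = \<theta>(x, - y)\<close>, and put
  \<open>F = (\<theta> + \<theta>') / 2\<close> and \<open>P = (\<theta> - \<theta>') / 2\<close>, so that \<open>F\<close> is the Hilbert fundamental
  function. Everything rests on the fact that the boundary point seen from \<open>x\<close> in direction \<open>y\<close> does
  not change when \<open>x\<close> moves while \<open>y\<close> is adjusted so as to keep pointing at it. If \<open>x\<close> moves along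
  \<open>y\<close>, this gives the derivatives \<open>\<theta>\<^sup>2\<close> and \<open>- \<theta>'\<^sup>2\<close> of \<open>\<theta>\<close> and \<open>\<theta>'\<close>, that is,
  \<open>2 F P\<close> for \<open>F\<close> and \<open>F\<^sup>2 + P\<^sup>2\<close> for \<open>P\<close> (\<open>hilbert_derivative_along\<close>,
  \<open>projective_factor_derivative_along\<close>). If \<open>x\<close> moves in an arbitrary direction, it gives Okada's
  equation, from which \<open>F\<^sub>x = (F P)\<^sub>y\<close> (\<open>dx_hilbert\<close>).

  For any Finsler function, contracting the Chern coefficients twice with \<open>y\<close> yields the spray
  coefficients, because the Cartan tensor is annihilated by \<open>y\<close> (\<open>contract_chern_coeff\<close>). For
  the Hilbert metric the two derivative formulas above identify the spray coefficients as \<open>2 P y\<close>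
  (\<open>contract_chern_coeff_hilbert\<close>). If the Chern coefficients depend on the base point only, then
  \<open>2 P(x, y) y\<close> is a quadratic map of \<open>y\<close>, and this forces \<open>P(x, \<cdot>)\<close> to be linear for every \<open>x\<close>
  (\<open>projective_factor_linear\<close>).

  Both conclusions follow from this linearity. The derivative of \<open>P(\<cdot>, y)\<close> along \<open>y\<close> is then a
  quadratic form in \<open>y\<close>; as it equals \<open>F\<^sup>2 + P\<^sup>2\<close>, so is \<open>F\<^sup>2\<close> (\<open>hilbert_squared\<close>). And for one
  fixed \<open>x\<close> in \<open>K\<close>, the form \<open>\<theta> \<theta>' = F\<^sup>2 - P\<^sup>2\<close> is positive definite, and \<open>x + y\<close> belongs to \<open>K\<close>
  iff \<open>\<theta> < 1\<close>, which is equivalent to the quadratic inequality \<open>F\<^sup>2 - P\<^sup>2 + 2 P < 1\<close>. Its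
  solution set is an ellipsoid (\<open>ellipsoid_K\<close>).
\<close>

section \<open>Smooth functions on the punctured tangent bundle\<close>

lemma Ck_on_cong:
  assumes "open S" "\<And>x. x \<in> S \<Longrightarrow> f x = g x" "Ck_on k f S"
  shows "Ck_on k g S"
  using assms(2,3)
proof (induction k arbitrary: f g)
  case 0
  then show ?case by (simp cong: continuous_on_cong)
next
  case (Suc k)
  have diff: "g differentiable (at x)" and eq: "frechet_derivative f (at x) = frechet_derivative g (at x)"
    if x: "x \<in> S" for x
  proof -
    have f: "f differentiable (at x)" using Suc.prems(2) x by simp
    show "g differentiable (at x)"
      using f Suc.prems(1) x \<open>open S\<close> unfolding differentiable_def
      by (metis has_derivative_transform_within_open)
    show "frechet_derivative f (at x) = frechet_derivative g (at x)"
      by (rule frechet_derivative_transform_within_open[OF f \<open>open S\<close> x]) (use Suc.prems in auto)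
  qed
  have "Ck_on k (\<lambda>x. frechet_derivative g (at x) v) S" for v
    by (rule Suc.IH[of "\<lambda>x. frechet_derivative f (at x) v"]) (use Suc.prems eq in auto)
  then show ?case using diff by simp
qed

lemma Ck_on_SucD: "Ck_on (Suc k) f S \<Longrightarrow> Ck_on k f S"
proof (induction k arbitrary: f)
  case 0
  then show ?case
    by (simp add: continuous_at_imp_continuous_on differentiable_imp_continuous_within)
next
  case (Suc k)
  then show ?case by (metis Ck_on.simps(2))
qed

lemma Ck_on_const: "Ck_on k (\<lambda>_. c) S"
  by (induction k arbitrary: c) simp_all

lemma Ck_on_add:
  assumes "open S" "Ck_on k f S" "Ck_on k g S"
  shows "Ck_on k (\<lambda>x. f x + g x) S"
  using assms(2,3)
proof (induction k arbitrary: f g)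
  case 0
  then show ?case by (simp add: continuous_on_add)
next
  case (Suc k)
  have "Ck_on k (\<lambda>x. frechet_derivative (\<lambda>x. f x + g x) (at x) v) S" for v
  proof (rule Ck_on_cong[OF \<open>open S\<close>])
    show "Ck_on k (\<lambda>x. frechet_derivative f (at x) v + frechet_derivative g (at x) v) S"
      using Suc by simp
    fix x assume "x \<in> S"
    then have "((\<lambda>x. f x + g x) has_derivative
        (\<lambda>v. frechet_derivative f (at x) v + frechet_derivative g (at x) v)) (at x)"
      using Suc.prems by (intro has_derivative_add) (simp_all flip: frechet_derivative_works)
    then show "frechet_derivative f (at x) v + frechet_derivative g (at x) v =
        frechet_derivative (\<lambda>x. f x + g x) (at x) v"
      by (simp flip: frechet_derivative_at)
  qed
  then show ?case using Suc.prems by simp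
qed

lemma Ck_on_mult:
  fixes f g :: "'a::euclidean_space \<Rightarrow> real"
  assumes "open S" "Ck_on k f S" "Ck_on k g S"
  shows "Ck_on k (\<lambda>x. f x * g x) S"
  using assms(2,3)
proof (induction k arbitrary: f g)
  case 0
  then show ?case by (simp add: continuous_on_mult)
next
  case (Suc k)
  have "Ck_on k (\<lambda>x. frechet_derivative (\<lambda>x. f x * g x) (at x) v) S" for v
  proof (rule Ck_on_cong[OF \<open>open S\<close>])
    show "Ck_on k (\<lambda>x. f x * frechet_derivative g (at x) v + frechet_derivative f (at x) v * g x) S"
      using Suc by (intro Ck_on_add \<open>open S\<close> Suc.IH) (auto intro: Ck_on_SucD)
    fix x assume "x \<in> S"
    then have "((\<lambda>x. f x * g x) has_derivative
        (\<lambda>v. f x * frechet_derivative g (at x) v + frechet_derivative f (at x) v * g x)) (at x)"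
      using Suc.prems by (intro has_derivative_mult) (simp_all flip: frechet_derivative_works)
    then show "f x * frechet_derivative g (at x) v + frechet_derivative f (at x) v * g x =
        frechet_derivative (\<lambda>x. f x * g x) (at x) v"
      by (simp flip: frechet_derivative_at)
  qed
  then show ?case using Suc.prems by simp
qed

text \<open>
  The vector \<open>0\<close> is left out of every fibre, because a Finsler function is smooth only away from
  the zero section.
\<close>

definition smooth_tangent :: "(real ^ 'n) set \<Rightarrow> 'n::finite tfun \<Rightarrow> bool" where
  "smooth_tangent K f \<longleftrightarrow> smooth_on (\<lambda>(x, y). f x y) (K \<times> (UNIV - {0}))"

lemma open_punctured: "open K \<Longrightarrow> open (K \<times> (UNIV - {0::'a::euclidean_space}))"
  by (intro open_Times) auto

lemma smooth_tangent_const: "smooth_tangent K (\<lambda>x y. c)"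
  by (simp add: smooth_tangent_def smooth_on_def case_prod_unfold Ck_on_const)

lemma smooth_tangent_mult:
  assumes "open K" "smooth_tangent K f" "smooth_tangent K g"
  shows "smooth_tangent K (\<lambda>x y. f x y * g x y)"
  using assms Ck_on_mult[OF open_punctured[OF \<open>open K\<close>]]
  by (fastforce simp: smooth_tangent_def smooth_on_def case_prod_unfold)

lemma smooth_tangent_differentiable:
  assumes "smooth_tangent K f" "x \<in> K" "y \<noteq> 0"
  shows "(\<lambda>(x, y). f x y) differentiable (at (x, y))"
proof -
  have "Ck_on (Suc 0) (\<lambda>(x, y). f x y) (K \<times> (UNIV - {0}))"
    using assms(1) by (simp only: smooth_tangent_def smooth_on_def)
  then show ?thesis using assms(2,3) by auto
qed

lemma smooth_tangent_continuous_on: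
  assumes "smooth_tangent K f"
  shows "continuous_on (K \<times> (UNIV - {0})) (\<lambda>(x, y). f x y)"
proof -
  have "Ck_on 0 (\<lambda>(x, y). f x y) (K \<times> (UNIV - {0}))"
    using assms by (simp only: smooth_tangent_def smooth_on_def)
  then show ?thesis by simp
qed

text \<open>
  Moving along a straight line in \<open>TK\<close> is the common generalization of \<open>dx\<close> and \<open>dy\<close>; the coordinate
  form \<open>directional_derivative_sum\<close> expresses its derivative through these two.
\<close>

lemma directional_derivative:
  fixes f :: "'n::finite tfun"
  assumes "(\<lambda>(x, y). f x y) differentiable (at (x, y))"
  shows "((\<lambda>t. f (x + t *\<^sub>R u) (y + t *\<^sub>R v)) has_real_derivative
           frechet_derivative (\<lambda>(x, y). f x y) (at (x, y)) (u, v)) (at 0)"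
proof -
  let ?D = "frechet_derivative (\<lambda>(x, y). f x y) (at (x, y))"
  have D: "((\<lambda>(x, y). f x y) has_derivative ?D) (at (x, y))"
    using assms by (simp flip: frechet_derivative_works)
  have "((\<lambda>t. (x + t *\<^sub>R u, y + t *\<^sub>R v)) has_derivative (\<lambda>t. (t *\<^sub>R u, t *\<^sub>R v))) (at (0::real))"
    by (auto intro!: derivative_eq_intros)
  from has_derivative_compose[OF this, of "\<lambda>(x, y). f x y" ?D] D
  have "((\<lambda>t. f (x + t *\<^sub>R u) (y + t *\<^sub>R v)) has_derivative (\<lambda>t. ?D (t *\<^sub>R u, t *\<^sub>R v))) (at 0)"
    by simp
  moreover have "?D (t *\<^sub>R u, t *\<^sub>R v) = ?D (u, v) * t" for t
    using linear_scale[OF has_derivative_linear[OF D], of t "(u, v)"] by simp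
  ultimately show ?thesis by (simp add: has_field_derivative_def)
qed

lemma dx_eq_frechet:
  assumes "(\<lambda>(x, y). f x y) differentiable (at (x, y))"
  shows "dx i f x y = frechet_derivative (\<lambda>(x, y). f x y) (at (x, y)) (axis i 1, 0)"
  unfolding dx_def using directional_derivative[OF assms, of "axis i 1" 0]
  by (intro DERIV_imp_deriv) simp

lemma dy_eq_frechet:
  assumes "(\<lambda>(x, y). f x y) differentiable (at (x, y))"
  shows "dy i f x y = frechet_derivative (\<lambda>(x, y). f x y) (at (x, y)) (0, axis i 1)"
  unfolding dy_def using directional_derivative[OF assms, of 0 "axis i 1"]
  by (intro DERIV_imp_deriv) simp

lemma directional_derivative_sum:
  fixes f :: "'n::finite tfun"
  assumes "(\<lambda>(x, y). f x y) differentiable (at (x, y))"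
  shows "((\<lambda>t. f (x + t *\<^sub>R u) (y + t *\<^sub>R v)) has_real_derivative
           (\<Sum>i\<in>UNIV. u $ i * dx i f x y) + (\<Sum>i\<in>UNIV. v $ i * dy i f x y)) (at 0)"
proof -
  let ?D = "frechet_derivative (\<lambda>(x, y). f x y) (at (x, y))"
  have lin: "linear ?D" using assms by (simp add: linear_frechet_derivative)
  have uv: "(u, v) = (\<Sum>i\<in>UNIV. u $ i *\<^sub>R (axis i 1, 0)) + (\<Sum>i\<in>UNIV. v $ i *\<^sub>R (0, axis i 1))"
  proof -
    have s: "(\<Sum>i\<in>UNIV. w $ i *\<^sub>R axis i 1) = w" for w :: "real ^ 'n"
      using basis_expansion[of w] by (simp add: scalar_mult_eq_scaleR)
    show ?thesis by (rule prod_eqI) (simp_all add: fst_sum snd_sum s)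
  qed
  have "?D (u, v) = (\<Sum>i\<in>UNIV. u $ i * dx i f x y) + (\<Sum>i\<in>UNIV. v $ i * dy i f x y)"
    by (subst uv) (simp only: linear_add[OF lin] linear_sum[OF lin] linear_scale[OF lin]
        dx_eq_frechet[OF assms] dy_eq_frechet[OF assms] real_scaleR_def)
  with directional_derivative[OF assms, of u v] show ?thesis by simp
qed

lemma smooth_tangent_dx:
  fixes f :: "'n::finite tfun"
  assumes "open K" "smooth_tangent K f"
  shows "smooth_tangent K (dx i f)"
  unfolding smooth_tangent_def smooth_on_def
proof
  fix k
  let ?W = "K \<times> (UNIV - {0 :: real ^ 'n})" and ?f = "\<lambda>(x, y). f x y"
  show "Ck_on k (\<lambda>(x, y). dx i f x y) ?W"
  proof (rule Ck_on_cong[OF open_punctured[OF \<open>open K\<close>]])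
    have "Ck_on (Suc k) ?f ?W"
      using assms by (simp only: smooth_tangent_def smooth_on_def)
    then show "Ck_on k (\<lambda>z. frechet_derivative ?f (at z) (axis i 1, 0)) ?W" by simp
    fix z assume "z \<in> ?W"
    then obtain x y where z: "z = (x, y)" "x \<in> K" "y \<noteq> 0" by auto
    then obtain x y where z: "z = (x, y)" "x \<in> K" "y \<noteq> 0" by auto
    show "frechet_derivative ?f (at z) (axis i 1, 0) = (case z of (x, y) \<Rightarrow> dx i f x y)"
      using smooth_tangent_differentiable[OF assms(2) z(2,3)] z(1) by (simp add: dx_eq_frechet)
  qed
qed

lemma smooth_tangent_dy:
  fixes f :: "'n::finite tfun"
  assumes "open K" "smooth_tangent K f"
  shows "smooth_tangent K (dy i f)"
  unfolding smooth_tangent_def smooth_on_def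
proof
  fix k
  let ?W = "K \<times> (UNIV - {0 :: real ^ 'n})" and ?f = "\<lambda>(x, y). f x y"
  show "Ck_on k (\<lambda>(x, y). dy i f x y) ?W"
  proof (rule Ck_on_cong[OF open_punctured[OF \<open>open K\<close>]])
    have "Ck_on (Suc k) ?f ?W"
      using assms by (simp only: smooth_tangent_def smooth_on_def)
    then show "Ck_on k (\<lambda>z. frechet_derivative ?f (at z) (0, axis i 1)) ?W" by simp
    fix z assume "z \<in> ?W"
    then obtain x y where z: "z = (x, y)" "x \<in> K" "y \<noteq> 0" by auto
    then obtain x y where z: "z = (x, y)" "x \<in> K" "y \<noteq> 0" by auto
    show "frechet_derivative ?f (at z) (0, axis i 1) = (case z of (x, y) \<Rightarrow> dy i f x y)"
      using smooth_tangent_differentiable[OF assms(2) z(2,3)] z(1) by (simp add: dy_eq_frechet)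
  qed
qed

lemma has_derivative_dx:
  assumes "(\<lambda>(x, y). f x y) differentiable (at (x, y))"
  shows "((\<lambda>t. f (x + t *\<^sub>R axis i 1) y) has_real_derivative dx i f x y) (at 0)"
  using directional_derivative[OF assms, of "axis i 1" 0] by (simp add: dx_eq_frechet[OF assms])

lemma has_derivative_dy:
  assumes "(\<lambda>(x, y). f x y) differentiable (at (x, y))"
  shows "((\<lambda>t. f x (y + t *\<^sub>R axis i 1)) has_real_derivative dy i f x y) (at 0)"
  using directional_derivative[OF assms, of 0 "axis i 1"] by (simp add: dy_eq_frechet[OF assms])

text \<open>
  Schwarz's theorem: by the mean value theorem, the second difference of \<open>f\<close> over the square with
  side \<open>h\<close> equals \<open>h\<^sup>2\<close> times a value of either mixed derivative inside the square.
\<close>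

lemma mixed_derivatives_eq:
  fixes f f1 f2 f12 f21 :: "real \<Rightarrow> real \<Rightarrow> real"
  assumes d: "d > 0"
    and f1: "\<And>s t. \<bar>s\<bar> < d \<Longrightarrow> \<bar>t\<bar> < d \<Longrightarrow> ((\<lambda>s. f s t) has_real_derivative f1 s t) (at s)"
    and f2: "\<And>s t. \<bar>s\<bar> < d \<Longrightarrow> \<bar>t\<bar> < d \<Longrightarrow> ((\<lambda>t. f s t) has_real_derivative f2 s t) (at t)"
    and f12: "\<And>s t. \<bar>s\<bar> < d \<Longrightarrow> \<bar>t\<bar> < d \<Longrightarrow> ((\<lambda>t. f1 s t) has_real_derivative f12 s t) (at t)"
    and f21: "\<And>s t. \<bar>s\<bar> < d \<Longrightarrow> \<bar>t\<bar> < d \<Longrightarrow> ((\<lambda>s. f2 s t) has_real_derivative f21 s t) (at s)"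
    and c12: "isCont (\<lambda>(s, t). f12 s t) (0, 0)"
    and c21: "isCont (\<lambda>(s, t). f21 s t) (0, 0)"
  shows "f12 0 0 = f21 0 0"
proof (rule ccontr)
  assume ne: "f12 0 0 \<noteq> f21 0 0"
  define e where "e = \<bar>f12 0 0 - f21 0 0\<bar> / 2"
  have e: "e > 0" using ne by (simp add: e_def)
  obtain r1 where r1: "r1 > 0" "\<And>z. dist z (0, 0) < r1 \<Longrightarrow> \<bar>f12 (fst z) (snd z) - f12 0 0\<bar> < e"
    using c12 e unfolding continuous_at_eps_delta by (force simp: dist_real_def case_prod_unfold)
  obtain r2 where r2: "r2 > 0" "\<And>z. dist z (0, 0) < r2 \<Longrightarrow> \<bar>f21 (fst z) (snd z) - f21 0 0\<bar> < e"
    using c21 e unfolding continuous_at_eps_delta by (force simp: dist_real_def case_prod_unfold)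
  define h where "h = min d (min r1 r2) / 3"
  have h: "0 < h" "h < d" "2 * h < r1" "2 * h < r2"
    using d r1(1) r2(1) by (auto simp: h_def min_def)
  obtain s where s: "0 < s" "s < h" "(f h h - f h 0) - (f 0 h - f 0 0) = (h - 0) * (f1 s h - f1 s 0)"
    using MVT2[of 0 h "\<lambda>s. f s h - f s 0" "\<lambda>s. f1 s h - f1 s 0"] h
    by (force intro!: DERIV_diff f1)
  obtain t where t: "0 < t" "t < h" "f1 s h - f1 s 0 = (h - 0) * f12 s t"
    using MVT2[of 0 h "\<lambda>t. f1 s t" "\<lambda>t. f12 s t"] h s by (force intro!: f12)
  obtain t' where t': "0 < t'" "t' < h" "(f h h - f 0 h) - (f h 0 - f 0 0) = (h - 0) * (f2 h t' - f2 0 t')"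
    using MVT2[of 0 h "\<lambda>t. f h t - f 0 t" "\<lambda>t. f2 h t - f2 0 t"] h
    by (force intro!: DERIV_diff f2)
  obtain s' where s': "0 < s'" "s' < h" "f2 h t' - f2 0 t' = (h - 0) * f21 s' t'"
    using MVT2[of 0 h "\<lambda>s. f2 s t'" "\<lambda>s. f21 s t'"] h t' by (force intro!: f21)
  have "h * (h * f12 s t) = h * (h * f21 s' t')"
    using s(3) t(3) t'(3) s'(3) by (simp add: algebra_simps)
  then have eq: "f12 s t = f21 s' t'" using h by simp
  have near: "dist (a, b) (0, 0) < 2 * h" if "0 < a" "a < h" "0 < b" "b < h" for a b :: real
    using norm_Pair_le[of a b] that by (simp add: dist_norm)
  have "\<bar>f12 s t - f12 0 0\<bar> < e" "\<bar>f21 s' t' - f21 0 0\<bar> < e"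
    using r1(2)[of "(s, t)"] r2(2)[of "(s', t')"] near[of s t] near[of s' t'] s t s' t' h by auto
  moreover have "2 * e = \<bar>f12 0 0 - f21 0 0\<bar>" by (simp add: e_def)
  ultimately show False using eq by (simp add: abs_if split: if_splits)
qed

lemma dx_dy_commute:
  fixes f :: "'n::finite tfun"
  assumes K: "open K" and f: "smooth_tangent K f" and x: "x \<in> K" and y: "y \<noteq> 0"
  shows "dx r (dy l f) x y = dy l (dx r f) x y"
proof -
  let ?X = "\<lambda>s. x + s *\<^sub>R axis r 1" and ?Y = "\<lambda>t. y + t *\<^sub>R axis l 1"
  obtain d1 where d1: "d1 > 0" "ball x d1 \<subseteq> K" using K x openE by blast
  \<comment> \<open>within this radius the base point stays in \<open>K\<close> and the tangent vector stays nonzero\<close>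
  define d where "d = min d1 (norm y)"
  have d: "d > 0" using d1 y by (simp add: d_def)
  have X: "?X s \<in> K" if "\<bar>s\<bar> < d" for s
    using that d1(2) by (auto simp: d_def subset_iff dist_norm norm_axis_1)
  have Y: "?Y t \<noteq> 0" if "\<bar>t\<bar> < d" for t
  proof
    assume "?Y t = 0"
    then have "y = - (t *\<^sub>R axis l 1)" by (simp add: eq_neg_iff_add_eq_0)
    then have "norm y = \<bar>t\<bar>" by (simp add: norm_axis_1)
    then show False using that by (simp add: d_def)
  qed
  have D1: "((\<lambda>s. g (?X s) (?Y t)) has_real_derivative dx r g (?X s) (?Y t)) (at s)"
    and D2: "((\<lambda>t. g (?X s) (?Y t)) has_real_derivative dy l g (?X s) (?Y t)) (at t)"
    if g: "smooth_tangent K g" and st: "\<bar>s\<bar> < d" "\<bar>t\<bar> < d" for g s t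
  proof -
    have diff: "(\<lambda>(x, y). g x y) differentiable (at (?X s, ?Y t))"
      using smooth_tangent_differentiable[OF g] X Y st by blast
    show "((\<lambda>s. g (?X s) (?Y t)) has_real_derivative dx r g (?X s) (?Y t)) (at s)"
      using has_derivative_dx[OF diff, of r]
        DERIV_shift[of "\<lambda>s. g (?X s) (?Y t)" _ 0 s] by (simp add: algebra_simps)
    show "((\<lambda>t. g (?X s) (?Y t)) has_real_derivative dy l g (?X s) (?Y t)) (at t)"
      using has_derivative_dy[OF diff, of l]
        DERIV_shift[of "\<lambda>t. g (?X s) (?Y t)" _ 0 t] by (simp add: algebra_simps)
  qed
  have cont: "isCont (\<lambda>(s, t). g (?X s) (?Y t)) (0, 0)" if g: "smooth_tangent K g" for g
  proof -
    have "isCont (\<lambda>(x, y). g x y) (x, y)"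
      using smooth_tangent_continuous_on[OF g] open_punctured[OF K] x y
      by (subst (asm) continuous_on_eq_continuous_at) auto
    moreover have "isCont (\<lambda>(s, t). (?X s, ?Y t)) (0, 0)"
      by (simp add: case_prod_unfold)
    ultimately show ?thesis
      using isCont_o2[of "(0, 0)" "\<lambda>(s, t). (?X s, ?Y t)" "\<lambda>(x, y). g x y"]
      by (simp add: case_prod_unfold)
  qed
  have "dy l (dx r f) (?X 0) (?Y 0) = dx r (dy l f) (?X 0) (?Y 0)"
    by (rule mixed_derivatives_eq[OF d, of "\<lambda>s t. f (?X s) (?Y t)"
          "\<lambda>s t. dx r f (?X s) (?Y t)" "\<lambda>s t. dy l f (?X s) (?Y t)"
          "\<lambda>s t. dy l (dx r f) (?X s) (?Y t)" "\<lambda>s t. dx r (dy l f) (?X s) (?Y t)"])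
       (intro D1 D2 cont smooth_tangent_dx smooth_tangent_dy K f; assumption)+
  then show ?thesis by simp
qed

lemma directional_derivative_axis:
  fixes f :: "'n::finite tfun"
  assumes "(\<lambda>(x, y). f x y) differentiable (at (x, y))"
  shows "((\<lambda>t. f (x + t *\<^sub>R axis l 1) (y + t *\<^sub>R (c *\<^sub>R axis l 1))) has_real_derivative
           dx l f x y + c * dy l f x y) (at 0)"
proof -
  have "(\<Sum>i\<in>UNIV. axis l 1 $ i * a i) = a l" for a :: "'n \<Rightarrow> real"
    by (simp add: axis_def if_distrib[of "\<lambda>z. z * _"] cong: if_cong)
  moreover have "(\<Sum>i\<in>UNIV. (c *\<^sub>R axis l 1) $ i * a i) = c * (\<Sum>i\<in>UNIV. axis l 1 $ i * a i)" for a :: "'n \<Rightarrow> real"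
    by (simp add: sum_distrib_left mult.assoc)
  ultimately show ?thesis
    using directional_derivative_sum[OF assms, of "axis l 1" "c *\<^sub>R axis l 1"] by simp
qed

lemma eventually_line_mem:
  fixes x v :: "'a::real_normed_vector"
  assumes "open S" "x \<in> S"
  shows "eventually (\<lambda>t::real. x + t *\<^sub>R v \<in> S) (nhds 0)"
proof -
  have "open ((\<lambda>t::real. x + t *\<^sub>R v) -` S)"
    by (intro open_vimage \<open>open S\<close> continuous_intros)
  from eventually_nhds_in_open[OF this, of 0] assms show ?thesis by simp
qed

section \<open>The Funk metric along lines\<close>

text \<open>
  Straight lines are geodesics of the Hilbert metric, but their affine parametrization is not
  geodesic. This function measures the defect: where the Hilbert metric is a Finsler metric, its
  spray has the form \<open>y \<partial>\<^sub>x - 2 P y \<partial>\<^sub>y\<close>.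
\<close>

definition projective_factor :: "(real ^ 'n::finite) set \<Rightarrow> 'n tfun" where
  "projective_factor K x y = (funk K x y - funk K x (- y)) / 2"

lemma funk_eq: "funk K x y = hilbert_fundamental K x y + projective_factor K x y"
  and funk_minus_eq: "funk K x (- y) = hilbert_fundamental K x y - projective_factor K x y"
  by (simp_all add: hilbert_fundamental_def projective_factor_def field_simps)

locale convex_domain =
  fixes K :: "(real ^ 'n::finite) set"
  assumes open_K: "open K" and bounded_K: "bounded K" and convex_K: "convex K"
begin

abbreviation F where "F \<equiv> hilbert_fundamental K"
abbreviation P where "P \<equiv> projective_factor K"

lemma funk_spec:
  assumes "p \<in> K" "u \<noteq> 0"
  shows "funk K p u > 0 \<and> p + (1 / funk K p u) *\<^sub>R u \<in> frontier K"
  using theI'[OF funk_well_defined[OF open_K bounded_K convex_K assms]] assms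
  by (simp add: funk_def)

lemma funk_eqI:
  assumes "p \<in> K" "u \<noteq> 0" "c > 0" "p + (1 / c) *\<^sub>R u \<in> frontier K"
  shows "funk K p u = c"
  using funk_spec[OF assms(1,2)] assms funk_well_defined[OF open_K bounded_K convex_K assms(1,2)]
  by blast

text \<open>
  This recovers \<open>K\<close> from the Funk metric in a single tangent space.
\<close>

lemma funk_less_1_iff:
  assumes x: "x \<in> K"
  shows "funk K x y < 1 \<longleftrightarrow> x + y \<in> K"
proof (cases "y = 0")
  case True
  then show ?thesis using x by (simp add: funk_def)
next
  case False
  define c where "c = funk K x y"
  define z where "z = x + (1 / c) *\<^sub>R y"
  have c: "c > 0" and z: "z \<in> frontier K"
    using funk_spec[OF x False] by (simp_all add: c_def z_def)
  have xint: "x \<in> interior K" using x open_K by (simp add: interior_open)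
  have zn: "z \<notin> K" and zc: "z \<in> closure K"
    using z open_K by (simp_all add: frontier_def interior_open)
  show ?thesis
  proof
    assume "funk K x y < 1"
    then have c1: "c < 1" by (simp add: c_def)
    have "x + y = (1 - c) *\<^sub>R x + c *\<^sub>R z" using c by (simp add: z_def algebra_simps)
    moreover have "x \<noteq> z" using x zn by auto
    ultimately have "x + y \<in> open_segment x z"
      unfolding in_segment using c c1 by (intro conjI exI[of _ c]) auto
    then have "x + y \<in> interior K"
      using in_interior_closure_convex_segment[OF convex_K xint zc] by blast
    then show "x + y \<in> K" using interior_subset by blast
  next
    assume xy: "x + y \<in> K"
    show "funk K x y < 1"
    proof (rule ccontr)
      assume "\<not> funk K x y < 1"
      then have c1: "c \<ge> 1" by (simp add: c_def)
      have "z = (1 - 1 / c) *\<^sub>R x + (1 / c) *\<^sub>R (x + y)"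
        by (simp add: z_def algebra_simps)
      also have "\<dots> \<in> K"
        using convexD[OF convex_K x xy, of "1 - 1 / c" "1 / c"] c c1 by simp
      finally show False using zn by blast
    qed
  qed
qed

text \<open>
  The boundary point seen from \<open>x\<close> in direction \<open>y\<close> stays the same when \<open>x\<close> moves along \<open>y\<close>.
\<close>

lemma funk_translate:
  assumes x: "x \<in> K" and xt: "x + t *\<^sub>R y \<in> K" and y: "y \<noteq> 0" and t: "t * funk K x y < 1"
  shows "funk K (x + t *\<^sub>R y) y = funk K x y / (1 - t * funk K x y)"
proof -
  define c where "c = funk K x y"
  have c: "c > 0" and z: "x + (1 / c) *\<^sub>R y \<in> frontier K"
    using funk_spec[OF x y] by (simp_all add: c_def)
  have "1 / (c / (1 - t * c)) = 1 / c - t" using c by (simp add: field_simps)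
  then have "x + t *\<^sub>R y + (1 / (c / (1 - t * c))) *\<^sub>R y = x + (1 / c) *\<^sub>R y"
    by (simp only:) (simp add: algebra_simps)
  moreover have "c / (1 - t * c) > 0" using c t by (simp add: c_def)
  ultimately have "funk K (x + t *\<^sub>R y) y = c / (1 - t * c)"
    using z by (intro funk_eqI[OF xt y]) (simp_all only:)
  then show ?thesis by (simp add: c_def)
qed

text \<open>
  More generally, \<open>x\<close> may move in any direction, if the tangent vector is turned so that it keeps
  pointing at the same boundary point.
\<close>

lemma funk_slide:
  assumes x: "x \<in> K" and y: "y \<noteq> 0" and xs: "x + v \<in> K"
    and ys: "y - funk K x y *\<^sub>R v \<noteq> 0"
  shows "funk K (x + v) (y - funk K x y *\<^sub>R v) = funk K x y"
proof -
  define c where "c = funk K x y"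
  have c: "c > 0" and z: "x + (1 / c) *\<^sub>R y \<in> frontier K"
    using funk_spec[OF x y] by (simp_all add: c_def)
  have "x + v + (1 / c) *\<^sub>R (y - c *\<^sub>R v) = x + (1 / c) *\<^sub>R y"
    using c by (simp add: algebra_simps)
  then show ?thesis
    using z c by (intro funk_eqI[OF xs ys]) (simp_all only: c_def)
qed

text \<open>
  By \<open>funk_translate\<close> the function has the explicit form \<open>c / (1 - t c)\<close> along the line, so that it is
  differentiable there however irregular the boundary of \<open>K\<close> may be.
\<close>

lemma funk_derivative_along:
  assumes x: "x \<in> K" and y: "y \<noteq> 0"
  shows "((\<lambda>t. funk K (x + t *\<^sub>R y) y) has_real_derivative (funk K x y)\<^sup>2) (at 0)"
proof -
  define c where "c = funk K x y"
  have "eventually (\<lambda>t. t * c < 1) (nhds 0)"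
  proof -
    have "open {t. t * c < 1}" by (intro open_Collect_less continuous_intros)
    then show ?thesis using eventually_nhds_in_open[of "{t. t * c < 1}" 0] by simp
  qed
  with eventually_line_mem[OF open_K x, of y]
  have "eventually (\<lambda>t. funk K (x + t *\<^sub>R y) y = c / (1 - t * c)) (nhds 0)"
    by eventually_elim (use funk_translate[OF x _ y] in \<open>simp add: c_def\<close>)
  moreover have "((\<lambda>t. c / (1 - t * c)) has_real_derivative c\<^sup>2) (at 0)"
    by (auto intro!: derivative_eq_intros simp: power2_eq_square)
  ultimately show ?thesis
    unfolding c_def by (subst DERIV_cong_ev[OF refl _ refl])
qed

lemma funk_minus_derivative_along:
  assumes x: "x \<in> K" and y: "y \<noteq> 0"
  shows "((\<lambda>t. funk K (x + t *\<^sub>R y) (- y)) has_real_derivative - (funk K x (- y))\<^sup>2) (at 0)"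
proof -
  have "((\<lambda>t. funk K (x + t *\<^sub>R - y) (- y)) has_real_derivative (funk K x (- y))\<^sup>2) (at (- 0))"
    using funk_derivative_along[OF x, of "- y"] y by simp
  then show ?thesis by (subst (asm) DERIV_mirror) simp
qed

lemma hilbert_derivative_along:
  assumes "x \<in> K" "y \<noteq> 0"
  shows "((\<lambda>t. F (x + t *\<^sub>R y) y) has_real_derivative 2 * F x y * P x y) (at 0)"
proof -
  have "((\<lambda>t. (funk K (x + t *\<^sub>R y) y + funk K (x + t *\<^sub>R y) (- y)) / 2) has_real_derivative
      ((funk K x y)\<^sup>2 + - (funk K x (- y))\<^sup>2) / 2) (at 0)"
    by (intro DERIV_cdivide DERIV_add funk_derivative_along funk_minus_derivative_along assms)
  moreover have "((funk K x y)\<^sup>2 + - (funk K x (- y))\<^sup>2) / 2 = 2 * F x y * P x y"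
    by (simp add: hilbert_fundamental_def projective_factor_def power2_eq_square field_simps)
  ultimately show ?thesis using DERIV_cong unfolding hilbert_fundamental_def by blast
qed

lemma projective_factor_derivative_along:
  assumes "x \<in> K" "y \<noteq> 0"
  shows "((\<lambda>t. P (x + t *\<^sub>R y) y) has_real_derivative (F x y)\<^sup>2 + (P x y)\<^sup>2) (at 0)"
proof -
  have "((\<lambda>t. (funk K (x + t *\<^sub>R y) y - funk K (x + t *\<^sub>R y) (- y)) / 2) has_real_derivative
      ((funk K x y)\<^sup>2 - - (funk K x (- y))\<^sup>2) / 2) (at 0)"
    by (intro DERIV_cdivide DERIV_diff funk_derivative_along funk_minus_derivative_along assms)
  moreover have "((funk K x y)\<^sup>2 - - (funk K x (- y))\<^sup>2) / 2 = (F x y)\<^sup>2 + (P x y)\<^sup>2"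
    by (simp add: hilbert_fundamental_def projective_factor_def power2_eq_square field_simps)
  ultimately show ?thesis using DERIV_cong unfolding projective_factor_def by blast
qed

lemma hilbert_pos: "x \<in> K \<Longrightarrow> y \<noteq> 0 \<Longrightarrow> F x y > 0"
  using funk_spec[of x y] funk_spec[of x "- y"] by (simp add: hilbert_fundamental_def)

end

locale finsler_domain = convex_domain K for K :: "(real ^ 'n::finite) set" +
  assumes finsler: "finsler_fundamental K (hilbert_fundamental K)"
begin

lemma smooth_hilbert: "smooth_tangent K F"
  using finsler by (simp add: finsler_fundamental_def smooth_tangent_def)

text \<open>
  The smoothness hypothesis concerns only the sum of the two Funk lengths. This formula transfers
  differentiability to their difference, and thereby to each of them.
\<close>

lemma projective_factor_eq:
  assumes "x \<in> K" "y \<noteq> 0"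
  shows "P x y = (\<Sum>i\<in>UNIV. y $ i * dx i F x y) / (2 * F x y)"
proof -
  have "((\<lambda>t. F (x + t *\<^sub>R y) y) has_real_derivative (\<Sum>i\<in>UNIV. y $ i * dx i F x y)) (at 0)"
    using directional_derivative_sum[OF smooth_tangent_differentiable[OF smooth_hilbert assms], of y 0]
    by simp
  from DERIV_unique[OF this hilbert_derivative_along[OF assms]] hilbert_pos[OF assms]
  show ?thesis by simp
qed

lemma differentiable_hilbert:
  "x \<in> K \<Longrightarrow> y \<noteq> 0 \<Longrightarrow> (\<lambda>(x, y). F x y) differentiable (at (x, y))"
  using smooth_tangent_differentiable[OF smooth_hilbert] .

lemma differentiable_projective_factor:
  assumes "x \<in> K" "y \<noteq> 0"
  shows "(\<lambda>(x, y). P x y) differentiable (at (x, y))"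
proof -
  let ?G = "\<lambda>z. (\<Sum>i\<in>UNIV. snd z $ i * (\<lambda>(x, y). dx i F x y) z) / (2 * (\<lambda>(x, y). F x y) z)"
  have "?G differentiable (at (x, y))"
  proof (intro differentiable_divide differentiable_sum differentiable_mult ballI)
    fix i
    have "bounded_linear (\<lambda>z :: (real ^ 'n) \<times> (real ^ 'n). snd z $ i)"
      by (intro bounded_linear_compose[OF bounded_linear_vec_nth] bounded_linear_snd)
    then show "(\<lambda>z :: (real ^ 'n) \<times> (real ^ 'n). snd z $ i) differentiable (at (x, y))"
      by (rule bounded_linear_imp_differentiable)
    show "(\<lambda>(x, y). dx i F x y) differentiable (at (x, y))"
      by (rule smooth_tangent_differentiable[OF smooth_tangent_dx[OF open_K smooth_hilbert] assms])
    show "(\<lambda>(x, y). F x y) differentiable (at (x, y))"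
      by (rule differentiable_hilbert[OF assms])
  qed (use hilbert_pos[OF assms] in auto)
  then obtain D where "(?G has_derivative D) (at (x, y))" by (auto simp: differentiable_def)
  then have "((\<lambda>(x, y). P x y) has_derivative D) (at (x, y))"
  proof (rule has_derivative_transform_within_open[OF _ open_punctured[OF open_K]])
    show "(x, y) \<in> K \<times> (UNIV - {0})" using assms by simp
    fix z :: "(real ^ 'n) \<times> (real ^ 'n)" assume "z \<in> K \<times> (UNIV - {0})"
    then obtain a b where z: "z = (a, b)" "a \<in> K" "b \<noteq> 0" by auto
    then show "?G z = (\<lambda>(x, y). P x y) z" using projective_factor_eq[OF z(2,3)] by simp
  qed
  then show ?thesis by (auto simp: differentiable_def)
qed

text \<open>
  Differentiating \<open>funk_slide\<close> gives Okada's equation \<open>\<theta>\<^sub>x = \<theta> \<theta>\<^sub>y\<close> for the Funk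
  metric \<open>\<theta> = F + P\<close>, and \<open>\<theta>'\<^sub>x = - \<theta>' \<theta>'\<^sub>y\<close> for the reverse Funk metric
  \<open>\<theta>' = F - P\<close>. Adding the two gives \<open>F\<^sub>x = (F P)\<^sub>y\<close>.
\<close>

lemma dx_hilbert:
  assumes x: "x \<in> K" and y: "y \<noteq> 0"
  shows "dx l F x y = F x y * dy l P x y + P x y * dy l F x y"
proof -
  let ?e = "axis l 1 :: real ^ 'n"
  have ev: "eventually (\<lambda>s. x + s *\<^sub>R ?e \<in> K \<and> y + s *\<^sub>R (c *\<^sub>R ?e) \<noteq> 0) (nhds 0)" for c
    using eventually_line_mem[OF open_K x, of ?e]
      eventually_line_mem[of "- {0}" y "c *\<^sub>R ?e"] y
    by (simp add: open_Compl eventually_conj_iff)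
  note D = directional_derivative_axis[OF differentiable_hilbert[OF assms], of l]
    directional_derivative_axis[OF differentiable_projective_factor[OF assms], of l]
  \<comment> \<open>moving \<open>(x, y)\<close> in the direction \<open>(e, - \<theta> e)\<close> keeps \<open>\<theta> = F + P\<close> constant\<close>
  have 1: "dx l F x y + - funk K x y * dy l F x y + (dx l P x y + - funk K x y * dy l P x y) = 0"
  proof (rule DERIV_unique)
    let ?f = "\<lambda>s. F (x + s *\<^sub>R ?e) (y + s *\<^sub>R (- funk K x y *\<^sub>R ?e)) +
      P (x + s *\<^sub>R ?e) (y + s *\<^sub>R (- funk K x y *\<^sub>R ?e))"
    show "(?f has_real_derivative
        dx l F x y + - funk K x y * dy l F x y + (dx l P x y + - funk K x y * dy l P x y)) (at 0)"
      by (intro DERIV_add D)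
    have "eventually (\<lambda>s. ?f s = funk K x y) (nhds 0)"
      using ev[of "- funk K x y"]
    proof eventually_elim
      case (elim s)
      then show ?case
        using funk_slide[OF x y, of "s *\<^sub>R ?e"] by (simp add: mult.commute flip: funk_eq)
    qed
    then show "(?f has_real_derivative 0) (at 0)"
      by (subst DERIV_cong_ev[OF refl _ refl, where g = "\<lambda>_. funk K x y"]) (assumption, rule DERIV_const)
  qed
  \<comment> \<open>moving \<open>(x, y)\<close> in the direction \<open>(e, \<theta>' e)\<close> keeps \<open>\<theta>' = F - P\<close> constant\<close>
  have 2: "dx l F x y + funk K x (- y) * dy l F x y - (dx l P x y + funk K x (- y) * dy l P x y) = 0"
  proof (rule DERIV_unique)
    let ?f = "\<lambda>s. F (x + s *\<^sub>R ?e) (y + s *\<^sub>R (funk K x (- y) *\<^sub>R ?e)) -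
      P (x + s *\<^sub>R ?e) (y + s *\<^sub>R (funk K x (- y) *\<^sub>R ?e))"
    show "(?f has_real_derivative
        dx l F x y + funk K x (- y) * dy l F x y - (dx l P x y + funk K x (- y) * dy l P x y)) (at 0)"
      by (intro DERIV_diff D)
    have "eventually (\<lambda>s. ?f s = funk K x (- y)) (nhds 0)"
      using ev[of "funk K x (- y)"]
    proof eventually_elim
      case (elim s)
      have "y + (funk K x (- y) * s) *\<^sub>R ?e = - (- y - (funk K x (- y) * s) *\<^sub>R ?e)" by simp
      then have "- y - (funk K x (- y) * s) *\<^sub>R ?e \<noteq> 0"
        using elim by (metis mult.commute neg_equal_0_iff_equal scaleR_scaleR)
      then show ?case
        using funk_slide[OF x, of "- y" "s *\<^sub>R ?e"] elim y
        by (simp add: mult.commute flip: funk_minus_eq)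
    qed
    then show "(?f has_real_derivative 0) (at 0)"
      by (subst DERIV_cong_ev[OF refl _ refl, where g = "\<lambda>_. funk K x (- y)"]) (assumption, rule DERIV_const)
  qed
  have "2 * dx l F x y = (funk K x y + funk K x (- y)) * dy l P x y + (funk K x y - funk K x (- y)) * dy l F x y"
    using 1 2 by (simp add: algebra_simps)
  then show ?thesis
    by (simp add: hilbert_fundamental_def projective_factor_def field_simps)
qed

end

section \<open>The Chern connection contracted with the direction\<close>

lemma dx_cong:
  fixes f g :: "'n::finite tfun"
  assumes "open K" "\<And>x y. x \<in> K \<Longrightarrow> y \<noteq> 0 \<Longrightarrow> f x y = g x y" "x \<in> K" "y \<noteq> 0"
  shows "dx i f x y = dx i g x y"
  unfolding dx_def
proof (rule deriv_cong_ev[OF _ refl])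
  have "eventually (\<lambda>t. x + t *\<^sub>R axis i 1 \<in> K) (nhds 0)"
    using eventually_line_mem[of K x "axis i 1"] assms by simp
  then show "eventually (\<lambda>t. f (x + t *\<^sub>R axis i 1) y = g (x + t *\<^sub>R axis i 1) y) (nhds 0)"
    by eventually_elim (use assms in auto)
qed

lemma dy_cong:
  fixes f g :: "'n::finite tfun"
  assumes "\<And>y. y \<noteq> 0 \<Longrightarrow> f x y = g x y" "y \<noteq> 0"
  shows "dy i f x y = dy i g x y"
  unfolding dy_def
proof (rule deriv_cong_ev[OF _ refl])
  have "eventually (\<lambda>t. y + t *\<^sub>R axis i 1 \<noteq> 0) (nhds 0)"
    using eventually_line_mem[of "- {0}" y "axis i 1"] assms by (simp add: open_Compl)
  then show "eventually (\<lambda>t. f x (y + t *\<^sub>R axis i 1) = g x (y + t *\<^sub>R axis i 1)) (nhds 0)"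
    by eventually_elim (use assms in auto)
qed

lemma horiz_deriv_cong:
  fixes f g :: "'n::finite tfun"
  assumes "open K" "\<And>x y. x \<in> K \<Longrightarrow> y \<noteq> 0 \<Longrightarrow> f x y = g x y" "x \<in> K" "y \<noteq> 0"
  shows "horiz_deriv F j f x y = horiz_deriv F j g x y"
proof -
  have "dx j f x y = dx j g x y" by (rule dx_cong) (use assms in auto)
  moreover have "dy m f x y = dy m g x y" for m by (rule dy_cong) (use assms in auto)
  ultimately show ?thesis by (simp add: horiz_deriv_def)
qed

lemma dx_contract:
  fixes h :: "'n::finite \<Rightarrow> 'n tfun"
  assumes "\<And>s. (\<lambda>(x, y). h s x y) differentiable (at (x, y))"
  shows "dx i (\<lambda>x y. \<Sum>s\<in>UNIV. y $ s * h s x y) x y = (\<Sum>s\<in>UNIV. y $ s * dx i (h s) x y)"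
  unfolding dx_def[of i "\<lambda>x y. \<Sum>s\<in>UNIV. y $ s * h s x y"]
  by (intro DERIV_imp_deriv DERIV_sum DERIV_cmult has_derivative_dx assms)

lemma dy_contract:
  fixes h :: "'n::finite \<Rightarrow> 'n tfun"
  assumes "\<And>s. (\<lambda>(x, y). h s x y) differentiable (at (x, y))"
  shows "dy i (\<lambda>x y. \<Sum>s\<in>UNIV. y $ s * h s x y) x y =
    h i x y + (\<Sum>s\<in>UNIV. y $ s * dy i (h s) x y)"
proof -
  have "((\<lambda>t. (y + t *\<^sub>R axis i 1) $ s * h s x (y + t *\<^sub>R axis i 1)) has_real_derivative
      axis i 1 $ s * h s x y + y $ s * dy i (h s) x y) (at 0)" for s
  proof -
    have "((\<lambda>t. (y + t *\<^sub>R axis i 1) $ s) has_real_derivative axis i 1 $ s) (at 0)"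
      by (auto intro!: derivative_eq_intros)
    from DERIV_mult[OF this has_derivative_dy[OF assms]] show ?thesis
      by (simp add: add.commute mult.commute)
  qed
  then have "dy i (\<lambda>x y. \<Sum>s\<in>UNIV. y $ s * h s x y) x y =
      (\<Sum>s\<in>UNIV. axis i 1 $ s * h s x y + y $ s * dy i (h s) x y)"
    unfolding dy_def[of i "\<lambda>x y. \<Sum>s\<in>UNIV. y $ s * h s x y"]
    by (intro DERIV_imp_deriv DERIV_sum)
  also have "\<dots> = h i x y + (\<Sum>s\<in>UNIV. y $ s * dy i (h s) x y)"
    by (simp add: sum.distrib axis_def if_distrib[of "\<lambda>z. z * _"] cong: if_cong)
  finally show ?thesis .
qed

text \<open>
  The radial derivative at \<open>y\<close> is computed once by the chain rule and once from the homogeneity.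
\<close>

lemma euler_homogeneous:
  fixes f :: "'n::finite tfun"
  assumes "(\<lambda>(x, y). f x y) differentiable (at (x, y))"
    and hom: "\<And>t. t > 0 \<Longrightarrow> f x (t *\<^sub>R y) = t ^ k * f x y"
  shows "(\<Sum>i\<in>UNIV. y $ i * dy i f x y) = real k * f x y"
proof (rule DERIV_unique)
  show "((\<lambda>t. f x (y + t *\<^sub>R y)) has_real_derivative (\<Sum>i\<in>UNIV. y $ i * dy i f x y)) (at 0)"
    using directional_derivative_sum[OF assms(1), of 0 y] by simp
  have "eventually (\<lambda>t::real. t \<in> {-1<..}) (nhds 0)"
    by (intro eventually_nhds_in_open) auto
  then have "eventually (\<lambda>t. f x (y + t *\<^sub>R y) = (1 + t) ^ k * f x y) (nhds 0)"
    by eventually_elim (use hom[of "1 + _"] in \<open>simp add: algebra_simps\<close>)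
  moreover have "((\<lambda>t. (1 + t) ^ k * f x y) has_real_derivative real k * f x y) (at 0)"
    by (auto intro!: derivative_eq_intros)
  ultimately show "((\<lambda>t. f x (y + t *\<^sub>R y)) has_real_derivative real k * f x y) (at 0)"
    by (subst DERIV_cong_ev[OF refl _ refl])
qed

lemma positive_definite_invertible:
  fixes A :: "real ^ 'n::finite ^ 'n"
  assumes "positive_definite A"
  shows "invertible A"
proof -
  have "x = 0" if "A *v x = 0" for x
    using assms that unfolding positive_definite_def by force
  then show ?thesis
    unfolding invertible_left_inverse matrix_left_invertible_ker by blast
qed

locale finsler_manifold =
  fixes K :: "(real ^ 'n::finite) set" and F :: "'n tfun"
  assumes open_M: "open K" and finsler_F: "finsler_fundamental K F"
begin

definition energy :: "'n tfun" where
  "energy x y = (F x y)\<^sup>2 / 2"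

lemma smooth_energy: "smooth_tangent K energy"
proof -
  have "smooth_tangent K F"
    using finsler_F by (simp add: finsler_fundamental_def smooth_tangent_def)
  then have "smooth_tangent K (\<lambda>x y. (F x y * F x y) * (1 / 2))"
    by (intro smooth_tangent_mult smooth_tangent_const open_M)
  then show ?thesis
    by (simp add: energy_def[abs_def] power2_eq_square)
qed

lemma fund_tensor_eq: "fund_tensor F i j = dy j (dy i energy)"
  by (simp add: fund_tensor_def energy_def[abs_def])

lemma smooth_dy_energy: "smooth_tangent K (dy i energy)"
  by (intro smooth_tangent_dy open_M smooth_energy)

lemma smooth_dx_energy: "smooth_tangent K (dx i energy)"
  by (intro smooth_tangent_dx open_M smooth_energy)

lemma smooth_fund_tensor: "smooth_tangent K (fund_tensor F i j)"
  unfolding fund_tensor_eq by (intro smooth_tangent_dy open_M smooth_energy)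

lemma fund_tensor_sym:
  assumes "x \<in> K" "y \<noteq> 0"
  shows "fund_tensor F i j x y = fund_tensor F j i x y"
proof -
  have "transpose (fund_matrix F x y) = fund_matrix F x y"
    using finsler_F assms by (simp add: finsler_fundamental_def positive_definite_def)
  then have "transpose (fund_matrix F x y) $ j $ i = fund_matrix F x y $ j $ i" by simp
  then show ?thesis by (simp add: transpose_def fund_matrix_def)
qed

lemma energy_homogeneous: "x \<in> K \<Longrightarrow> t > 0 \<Longrightarrow> energy x (t *\<^sub>R y) = t\<^sup>2 * energy x y"
  using finsler_F by (simp add: energy_def finsler_fundamental_def power_mult_distrib)

lemma dy_energy_homogeneous:
  assumes x: "x \<in> K" and y: "y \<noteq> 0" and t: "t > 0"
  shows "dy l energy x (t *\<^sub>R y) = t * dy l energy x y"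
proof -
  have "((\<lambda>s. energy x (y + s *\<^sub>R axis l 1)) has_real_derivative dy l energy x y) (at (0 / t))"
    using has_derivative_dy[OF smooth_tangent_differentiable[OF smooth_energy x y]] by simp
  moreover have "((\<lambda>s. s / t) has_real_derivative 1 / t) (at 0)"
    by (intro DERIV_cdivide DERIV_ident)
  ultimately have "((\<lambda>s. energy x (y + (s / t) *\<^sub>R axis l 1)) has_real_derivative
      dy l energy x y * (1 / t)) (at 0)"
    by (rule DERIV_chain2)
  then have "((\<lambda>s. t\<^sup>2 * energy x (y + (s / t) *\<^sub>R axis l 1)) has_real_derivative
      t\<^sup>2 * (dy l energy x y * (1 / t))) (at 0)"
    by (rule DERIV_cmult)
  moreover have "t\<^sup>2 * energy x (y + (s / t) *\<^sub>R axis l 1) = energy x (t *\<^sub>R y + s *\<^sub>R axis l 1)" for s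
    using energy_homogeneous[OF x t, of "y + (s / t) *\<^sub>R axis l 1"] t by (simp add: scaleR_add_right)
  moreover have "t\<^sup>2 * (dy l energy x y * (1 / t)) = t * dy l energy x y"
    using t by (simp add: power2_eq_square)
  ultimately show ?thesis
    unfolding dy_def[of l energy x "t *\<^sub>R y"] by (intro DERIV_imp_deriv) simp
qed

lemma contract_fund_tensor:
  assumes "x \<in> K" "y \<noteq> 0"
  shows "(\<Sum>s\<in>UNIV. y $ s * fund_tensor F l s x y) = dy l energy x y"
  using euler_homogeneous[of "dy l energy" x y 1]
    smooth_tangent_differentiable[OF smooth_dy_energy assms] dy_energy_homogeneous[OF assms]
  by (simp add: fund_tensor_eq)

lemma contract_dy_energy:
  assumes "x \<in> K" "y \<noteq> 0"
  shows "(\<Sum>l\<in>UNIV. y $ l * dy l energy x y) = 2 * energy x y"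
  using euler_homogeneous[of energy x y 2]
    smooth_tangent_differentiable[OF smooth_energy assms] energy_homogeneous[OF assms(1)]
  by simp

lemma contract_dx_fund_tensor:
  assumes "x \<in> K" "y \<noteq> 0"
  shows "(\<Sum>s\<in>UNIV. y $ s * dx r (fund_tensor F l s) x y) = dx r (dy l energy) x y"
proof -
  have "dx r (\<lambda>x y. \<Sum>s\<in>UNIV. y $ s * fund_tensor F l s x y) x y = dx r (dy l energy) x y"
    by (rule dx_cong[OF open_M contract_fund_tensor assms])
  then show ?thesis
    by (subst (asm) dx_contract) (rule smooth_tangent_differentiable[OF smooth_fund_tensor assms])
qed

text \<open>
  The Cartan tensor vanishes when it is contracted with \<open>y\<close>: differentiate the identity
  \<open>contract_fund_tensor\<close> in the fibre, where the term from the factor \<open>y\<close> already gives the whole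
  right-hand side.
\<close>

lemma contract_dy_fund_tensor:
  assumes "x \<in> K" "y \<noteq> 0"
  shows "(\<Sum>s\<in>UNIV. y $ s * dy m (fund_tensor F l s) x y) = 0"
proof -
  have "dy m (\<lambda>x y. \<Sum>s\<in>UNIV. y $ s * fund_tensor F l s x y) x y = dy m (dy l energy) x y"
    by (rule dy_cong) (use assms contract_fund_tensor in auto)
  then have "fund_tensor F l m x y + (\<Sum>s\<in>UNIV. y $ s * dy m (fund_tensor F l s) x y) = fund_tensor F l m x y"
    using dy_contract[OF smooth_tangent_differentiable[OF smooth_fund_tensor assms]]
    by (simp add: fund_tensor_eq)
  then show ?thesis by simp
qed

lemma contract_horiz_deriv:
  assumes "x \<in> K" "y \<noteq> 0"
  shows "(\<Sum>k\<in>UNIV. y $ k * horiz_deriv F j (fund_tensor F l k) x y) = dx j (dy l energy) x y"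
proof -
  have "(\<Sum>k\<in>UNIV. y $ k * horiz_deriv F j (fund_tensor F l k) x y) =
      (\<Sum>k\<in>UNIV. y $ k * dx j (fund_tensor F l k) x y) -
      (\<Sum>k\<in>UNIV. \<Sum>m\<in>UNIV. nonlinear_conn F m j x y * (y $ k * dy m (fund_tensor F l k) x y))"
    unfolding horiz_deriv_def
    by (simp add: right_diff_distrib sum_subtractf sum_distrib_left algebra_simps)
  also have "(\<Sum>k\<in>UNIV. \<Sum>m\<in>UNIV. nonlinear_conn F m j x y * (y $ k * dy m (fund_tensor F l k) x y)) = 0"
    by (subst sum.swap) (simp add: contract_dy_fund_tensor[OF assms] flip: sum_distrib_left)
  finally show ?thesis by (simp add: contract_dx_fund_tensor[OF assms])
qed

lemma contract_dx_dy_energy: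
  assumes "x \<in> K" "y \<noteq> 0"
  shows "(\<Sum>j\<in>UNIV. y $ j * dx l (dy j energy) x y) = 2 * dx l energy x y"
proof -
  have "dx l (\<lambda>x y. \<Sum>j\<in>UNIV. y $ j * dy j energy x y) x y = dx l (\<lambda>x y. 2 * energy x y) x y"
    by (rule dx_cong[OF open_M contract_dy_energy assms])
  also have "\<dots> = 2 * dx l energy x y"
    unfolding dx_def[of l "\<lambda>x y. 2 * energy x y"]
    by (intro DERIV_imp_deriv DERIV_cmult has_derivative_dx
        smooth_tangent_differentiable[OF smooth_energy assms])
  finally show ?thesis
    by (subst (asm) dx_contract) (rule smooth_tangent_differentiable[OF smooth_dy_energy assms])
qed

text \<open>
  Each fundamental tensor in the sum meets a factor \<open>y\<close> in one of its own indices. Hence the terms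
  with the nonlinear connection drop out by \<open>contract_dy_fund_tensor\<close>, and the remaining ones are
  derivatives of the energy: the result is the vector of spray coefficients.
\<close>

lemma contract_chern_coeff:
  assumes xy: "x \<in> K" "y \<noteq> 0"
  shows "(\<Sum>j\<in>UNIV. \<Sum>k\<in>UNIV. y $ j * y $ k * chern_coeff F i j k x y) =
    (\<Sum>l\<in>UNIV. fund_tensor_inv F i l x y *
      ((\<Sum>j\<in>UNIV. y $ j * dx j (dy l energy) x y) - dx l energy x y))"
proof -
  let ?h = "\<lambda>j l k. horiz_deriv F j (fund_tensor F l k) x y"
  have sym: "?h k j l = ?h k l j" for j k l
    by (rule horiz_deriv_cong[OF open_M fund_tensor_sym xy])
  have "(\<Sum>j\<in>UNIV. \<Sum>k\<in>UNIV. y $ j * y $ k * (?h j l k + ?h k j l - ?h l j k)) =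
      2 * ((\<Sum>j\<in>UNIV. y $ j * dx j (dy l energy) x y) - dx l energy x y)" for l
  proof -
    have 1: "(\<Sum>j\<in>UNIV. \<Sum>k\<in>UNIV. y $ j * y $ k * ?h j l k) = (\<Sum>j\<in>UNIV. y $ j * dx j (dy l energy) x y)"
      by (simp add: contract_horiz_deriv[OF xy] mult.assoc flip: sum_distrib_left)
    have 2: "(\<Sum>j\<in>UNIV. \<Sum>k\<in>UNIV. y $ j * y $ k * ?h k j l) = (\<Sum>j\<in>UNIV. y $ j * dx j (dy l energy) x y)"
      unfolding 1[symmetric] by (subst sum.swap) (simp only: sym mult.commute)
    have 3: "(\<Sum>j\<in>UNIV. \<Sum>k\<in>UNIV. y $ j * y $ k * ?h l j k) = 2 * dx l energy x y"
      by (simp add: contract_horiz_deriv[OF xy] mult.assoc contract_dx_dy_energy[OF xy] flip: sum_distrib_left)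
    show ?thesis
      using 1 2 3 by (simp add: distrib_left right_diff_distrib sum.distrib sum_subtractf)
  qed
  note contr = this
  have "(\<Sum>j\<in>UNIV. \<Sum>k\<in>UNIV. y $ j * y $ k * chern_coeff F i j k x y) =
      (\<Sum>j\<in>UNIV. \<Sum>k\<in>UNIV. \<Sum>l\<in>UNIV. (1 / 2) * fund_tensor_inv F i l x y *
        (y $ j * y $ k * (?h j l k + ?h k j l - ?h l j k)))"
    unfolding chern_coeff_def by (simp add: sum_distrib_left mult_ac)
  also have "\<dots> = (\<Sum>j\<in>UNIV. \<Sum>l\<in>UNIV. \<Sum>k\<in>UNIV. (1 / 2) * fund_tensor_inv F i l x y *
        (y $ j * y $ k * (?h j l k + ?h k j l - ?h l j k)))"
    by (intro sum.cong refl sum.swap)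
  also have "\<dots> = (\<Sum>l\<in>UNIV. \<Sum>j\<in>UNIV. \<Sum>k\<in>UNIV. (1 / 2) * fund_tensor_inv F i l x y *
        (y $ j * y $ k * (?h j l k + ?h k j l - ?h l j k)))"
    by (rule sum.swap)
  also have "\<dots> = (\<Sum>l\<in>UNIV. (1 / 2) * fund_tensor_inv F i l x y *
      (\<Sum>j\<in>UNIV. \<Sum>k\<in>UNIV. y $ j * y $ k * (?h j l k + ?h k j l - ?h l j k)))"
    by (simp only: sum_distrib_left)
  also have "\<dots> = (\<Sum>l\<in>UNIV. fund_tensor_inv F i l x y *
      ((\<Sum>j\<in>UNIV. y $ j * dx j (dy l energy) x y) - dx l energy x y))"
    unfolding contr by (intro sum.cong refl) (simp add: algebra_simps)
  finally show ?thesis .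
qed

text \<open>
  The fibre derivative of the energy is \<open>y\<close> with its index lowered; the inverse tensor raises it again.
\<close>

lemma spray_coefficient_cancel:
  assumes xy: "x \<in> K" "y \<noteq> 0"
  shows "(\<Sum>l\<in>UNIV. fund_tensor_inv F i l x y * dy l energy x y) = y $ i"
proof -
  let ?A = "fund_matrix F x y"
  have "invertible ?A"
    using finsler_F xy by (auto simp: finsler_fundamental_def intro: positive_definite_invertible)
  then have "matrix_inv ?A ** ?A = mat 1"
    unfolding invertible_def matrix_inv_def by (rule someI2_ex) simp
  then have inv: "matrix_inv ?A *v (?A *v y) = y"
    by (simp add: matrix_vector_mul_assoc)
  have "(?A *v y) $ l = dy l energy x y" for l
    using contract_fund_tensor[OF xy, of l]
    by (simp add: matrix_vector_mult_def fund_matrix_def mult.commute)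
  then have "(\<Sum>l\<in>UNIV. fund_tensor_inv F i l x y * dy l energy x y) = (matrix_inv ?A *v (?A *v y)) $ i"
    by (simp add: matrix_vector_mult_def[of "matrix_inv ?A"] fund_tensor_inv_def)
  then show ?thesis by (simp add: inv)
qed

end

sublocale finsler_domain \<subseteq> finsler_manifold K F
  by unfold_locales (fact open_K, fact finsler)

context finsler_domain
begin

lemma dy_energy:
  assumes "x \<in> K" "y \<noteq> 0"
  shows "dy l energy x y = F x y * dy l F x y"
  unfolding energy_def[abs_def] dy_def[of l "\<lambda>x y. (F x y)\<^sup>2 / 2"]
proof (rule DERIV_imp_deriv)
  show "((\<lambda>t. (F x (y + t *\<^sub>R axis l 1))\<^sup>2 / 2) has_real_derivative F x y * dy l F x y) (at 0)"
    using has_derivative_dy[OF differentiable_hilbert[OF assms], of l]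
    by (auto intro!: derivative_eq_intros)
qed

lemma dx_energy:
  assumes "x \<in> K" "y \<noteq> 0"
  shows "dx l energy x y = F x y * dx l F x y"
  unfolding energy_def[abs_def] dx_def[of l "\<lambda>x y. (F x y)\<^sup>2 / 2"]
proof (rule DERIV_imp_deriv)
  show "((\<lambda>t. (F (x + t *\<^sub>R axis l 1) y)\<^sup>2 / 2) has_real_derivative F x y * dx l F x y) (at 0)"
    using has_derivative_dx[OF differentiable_hilbert[OF assms], of l]
    by (auto intro!: derivative_eq_intros)
qed

lemma contract_dx_energy:
  assumes "x \<in> K" "y \<noteq> 0"
  shows "(\<Sum>j\<in>UNIV. y $ j * dx j energy x y) = 2 * P x y * (F x y)\<^sup>2"
  using projective_factor_eq[OF assms] hilbert_pos[OF assms]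
  by (simp add: dx_energy[OF assms] power2_eq_square mult.left_commute[of _ "F x y"] flip: sum_distrib_left)

text \<open>
  After the mixed derivatives are exchanged, the first sum comes from differentiating
  \<open>contract_dx_energy\<close> in the fibre; the term \<open>F\<^sub>x\<close> that remains is replaced by Okada's
  equation in the form \<open>dx_hilbert\<close>.
\<close>

lemma spray_eq:
  assumes xy: "x \<in> K" "y \<noteq> 0"
  shows "(\<Sum>j\<in>UNIV. y $ j * dx j (dy l energy) x y) - dx l energy x y = 2 * P x y * dy l energy x y"
proof -
  have "(\<Sum>j\<in>UNIV. y $ j * dx j (dy l energy) x y) = (\<Sum>j\<in>UNIV. y $ j * dy l (dx j energy) x y)"
    by (intro sum.cong refl arg_cong2[where f = "(*)"] dx_dy_commute[OF open_K smooth_energy xy])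
  also have "dx l energy x y + \<dots> = dy l (\<lambda>x y. \<Sum>j\<in>UNIV. y $ j * dx j energy x y) x y"
    by (rule dy_contract[symmetric]) (rule smooth_tangent_differentiable[OF smooth_dx_energy xy])
  also have "\<dots> = dy l (\<lambda>x y. 2 * P x y * (F x y)\<^sup>2) x y"
    by (rule dy_cong) (use xy contract_dx_energy in auto)
  also have "\<dots> = 2 * dy l P x y * (F x y)\<^sup>2 + 4 * P x y * F x y * dy l F x y"
    unfolding dy_def[of l "\<lambda>x y. 2 * P x y * (F x y)\<^sup>2"]
    using has_derivative_dy[OF differentiable_hilbert[OF xy], of l]
      has_derivative_dy[OF differentiable_projective_factor[OF xy], of l]
    by (intro DERIV_imp_deriv) (auto intro!: derivative_eq_intros simp: algebra_simps)
  finally show ?thesis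
    by (simp add: dx_energy[OF xy] dy_energy[OF xy] dx_hilbert[OF xy] power2_eq_square algebra_simps)
qed

lemma contract_chern_coeff_hilbert:
  assumes xy: "x \<in> K" "y \<noteq> 0"
  shows "(\<Sum>j\<in>UNIV. \<Sum>k\<in>UNIV. y $ j * y $ k * chern_coeff F i j k x y) = 2 * P x y * y $ i"
  unfolding contract_chern_coeff[OF xy] spray_eq[OF xy]
  by (simp add: mult.left_commute[of _ "2 * P x y"] spray_coefficient_cancel[OF xy] flip: sum_distrib_left)

end

section \<open>Linearity of the projective factor\<close>

text \<open>
  For independent \<open>u\<close> and \<open>v\<close>, insert \<open>u + v\<close> and \<open>u - v\<close> into the parallelogram law of \<open>B\<close>. The
  coefficients of \<open>u\<close> and \<open>v\<close> give \<open>q (u + v) + q (u - v) = 2 q u\<close> and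
  \<open>q (u + v) - q (u - v) = 2 q v\<close>, whose sum is additivity. On a single line additivity follows from
  homogeneity. The value at \<open>0\<close> is a separate hypothesis, since the equation does not determine it.
\<close>

lemma radial_quadratic_map_linear:
  fixes q :: "'a::euclidean_space \<Rightarrow> real" and B :: "'a \<Rightarrow> 'a \<Rightarrow> 'a"
  assumes B: "bilinear B" and q: "\<And>y. q y *\<^sub>R y = B y y" and q0: "q 0 = 0"
  shows "linear q"
proof -
  have scale: "q (t *\<^sub>R y) = t * q y" for t y
  proof (cases "t = 0 \<or> y = 0")
    case True
    then show ?thesis using q0 by auto
  next
    case False
    have "(q (t *\<^sub>R y) * t) *\<^sub>R y = t *\<^sub>R t *\<^sub>R B y y"
      using q[of "t *\<^sub>R y"] by (simp add: bilinear_lmul[OF B] bilinear_rmul[OF B])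
    also have "\<dots> = (t * q y * t) *\<^sub>R y" by (simp flip: q)
    finally show ?thesis using False by simp
  qed
  have add: "q (u + v) = q u + q v" for u v
  proof (cases "\<exists>a. u = a *\<^sub>R v \<or> v = a *\<^sub>R u")
    case True
    then obtain a where "u = a *\<^sub>R v \<or> v = a *\<^sub>R u" by blast
    then show ?thesis
    proof
      assume u: "u = a *\<^sub>R v"
      then have "u + v = (a + 1) *\<^sub>R v" by (simp add: scaleR_left_distrib)
      then have "q (u + v) = (a + 1) * q v" by (simp only: scale)
      then show ?thesis by (simp add: u scale distrib_right)
    next
      assume v: "v = a *\<^sub>R u"
      then have "u + v = (a + 1) *\<^sub>R u" by (simp add: scaleR_left_distrib)
      then have "q (u + v) = (a + 1) * q u" by (simp only: scale)
      then show ?thesis by (simp add: v scale distrib_right)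
    qed
  next
    case False
    have indep: "a = 0 \<and> b = 0" if ab: "a *\<^sub>R u + b *\<^sub>R v = 0" for a b
    proof (rule ccontr)
      assume "\<not> (a = 0 \<and> b = 0)"
      then consider "a \<noteq> 0" | "b \<noteq> 0" by blast
      then show False
      proof cases
        case 1
        have "a *\<^sub>R u = (- b) *\<^sub>R v" using ab by (simp add: eq_neg_iff_add_eq_0)
        then have "(1 / a) *\<^sub>R (a *\<^sub>R u) = (1 / a) *\<^sub>R ((- b) *\<^sub>R v)" by (simp only:)
        then have "u = (- b / a) *\<^sub>R v" using 1 by simp
        then show False using False by blast
      next
        case 2
        have "b *\<^sub>R v = (- a) *\<^sub>R u" using ab by (simp add: eq_neg_iff_add_eq_0 add.commute)
        then have "(1 / b) *\<^sub>R (b *\<^sub>R v) = (1 / b) *\<^sub>R ((- a) *\<^sub>R u)" by (simp only:)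
        then have "v = (- a / b) *\<^sub>R u" using 2 by simp
        then show False using False by blast
      qed
    qed
    have "B (u + v) (u + v) + B (u - v) (u - v) = 2 *\<^sub>R B u u + 2 *\<^sub>R B v v"
      by (simp add: bilinear_ladd[OF B] bilinear_radd[OF B] bilinear_lsub[OF B] bilinear_rsub[OF B] scaleR_2)
    then have "(q (u + v) + q (u - v) - 2 * q u) *\<^sub>R u + (q (u + v) - q (u - v) - 2 * q v) *\<^sub>R v = 0"
      by (simp flip: q add: algebra_simps)
    from indep[OF this] show ?thesis by simp
  qed
  show ?thesis by (rule linearI) (simp_all add: add scale)
qed

lemma quadratic_form_sum:
  fixes A :: "real ^ 'n::finite ^ 'n"
  shows "y \<bullet> (A *v y) = (\<Sum>i\<in>UNIV. \<Sum>j\<in>UNIV. y $ i * y $ j * A $ i $ j)"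
  by (simp add: inner_vec_def matrix_vector_mult_def sum_distrib_left mult_ac)

locale berwald_domain = finsler_domain K for K :: "(real ^ 'n::finite) set" +
  assumes berwald: "berwald_type K (hilbert_fundamental K)"
begin

text \<open>
  The Berwald condition makes the left-hand side of \<open>contract_chern_coeff_hilbert\<close> a quadratic map
  in \<open>y\<close>, which always points in the direction \<open>y\<close>.
\<close>

lemma projective_factor_linear:
  assumes x: "x \<in> K"
  shows "linear (P x)"
proof -
  \<comment> \<open>the coefficients may be read off at any nonzero tangent vector\<close>
  define \<Gamma> where "\<Gamma> i j k = chern_coeff F i j k x (axis undefined 1)" for i j k
  have \<Gamma>: "chern_coeff F i j k x y = \<Gamma> i j k" if "y \<noteq> 0" for i j k y
  proof -
    have "(axis undefined 1 :: real ^ 'n) \<noteq> 0" by (simp add: axis_eq_0_iff)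
    then show ?thesis using berwald x that unfolding berwald_type_def \<Gamma>_def by blast
  qed
  define B where "B u v = (\<chi> i. \<Sum>j\<in>UNIV. \<Sum>k\<in>UNIV. u $ j * v $ k * \<Gamma> i j k)"
    for u v :: "real ^ 'n"
  have "bilinear B"
    unfolding bilinear_def
  proof (intro conjI allI linearI)
    fix u u' v :: "real ^ 'n" and c :: real
    show "B u (v + u') = B u v + B u u'" "B (u + u') v = B u v + B u' v"
      by (simp_all add: B_def vec_eq_iff distrib_left distrib_right sum.distrib)
    show "B u (c *\<^sub>R v) = c *\<^sub>R B u v" "B (c *\<^sub>R u) v = c *\<^sub>R B u v"
      by (simp_all add: B_def vec_eq_iff sum_distrib_left mult_ac)
  qed
  moreover have "(2 * P x y) *\<^sub>R y = B y y" for y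
  proof (cases "y = 0")
    case True
    then show ?thesis by (simp add: B_def vec_eq_iff)
  next
    case False
    have "B y y $ i = 2 * P x y * y $ i" for i
      using contract_chern_coeff_hilbert[OF x False, of i] by (simp add: B_def \<Gamma>[OF False])
    then show ?thesis by (simp add: vec_eq_iff)
  qed
  moreover have "2 * P x 0 = 0" by (simp add: projective_factor_def)
  ultimately have lin: "linear (\<lambda>y. 2 * P x y)"
    by (rule radial_quadratic_map_linear[where q = "\<lambda>y. 2 * P x y" and B = B])
  show ?thesis
  proof (rule linearI)
    fix u v :: "real ^ 'n" and c :: real
    show "P x (u + v) = P x u + P x v" using linear_add[OF lin, of u v] by simp
    show "P x (c *\<^sub>R v) = c *\<^sub>R P x v" using linear_scale[OF lin, of c v] by simp
  qed
qed

lemma projective_factor_expand: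
  assumes "x \<in> K"
  shows "P x y = (\<Sum>i\<in>UNIV. y $ i * P x (axis i 1))"
proof -
  have "y = (\<Sum>i\<in>UNIV. y $ i *\<^sub>R axis i 1)"
    using basis_expansion[of y] by (simp add: scalar_mult_eq_scaleR)
  then have "P x y = P x (\<Sum>i\<in>UNIV. y $ i *\<^sub>R axis i 1)" by simp
  also have "\<dots> = (\<Sum>i\<in>UNIV. y $ i * P x (axis i 1))"
    using projective_factor_linear[OF assms] by (simp add: linear_sum linear_scale)
  finally show ?thesis .
qed

section \<open>The square of the Hilbert fundamental function\<close>

text \<open>
  Along the line through \<open>x\<close> in direction \<open>y\<close> the derivative of \<open>P\<close> is \<open>F\<^sup>2 + P\<^sup>2\<close>. Since \<open>P\<close> is
  linear in each tangent space, the same derivative is a quadratic form in \<open>y\<close>.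
\<close>

lemma hilbert_squared:
  assumes x: "x \<in> K"
  shows "(F x y)\<^sup>2 = (\<Sum>i\<in>UNIV. \<Sum>j\<in>UNIV. y $ i * y $ j * dx j P x (axis i 1)) - (P x y)\<^sup>2"
proof (cases "y = 0")
  case True
  then show ?thesis by (simp add: hilbert_fundamental_def projective_factor_def funk_def)
next
  case False
  have "((\<lambda>t. \<Sum>i\<in>UNIV. y $ i * P (x + t *\<^sub>R y) (axis i 1)) has_real_derivative
      (\<Sum>i\<in>UNIV. y $ i * (\<Sum>j\<in>UNIV. y $ j * dx j P x (axis i 1)))) (at 0)"
  proof (intro DERIV_sum DERIV_cmult)
    fix i :: 'n
    have "(axis i 1 :: real ^ 'n) \<noteq> 0" by (simp add: axis_eq_0_iff)
    from directional_derivative_sum[OF differentiable_projective_factor[OF x this], of y 0]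
    show "((\<lambda>t. P (x + t *\<^sub>R y) (axis i 1)) has_real_derivative
        (\<Sum>j\<in>UNIV. y $ j * dx j P x (axis i 1))) (at 0)" by simp
  qed
  moreover have "eventually (\<lambda>t. P (x + t *\<^sub>R y) y = (\<Sum>i\<in>UNIV. y $ i * P (x + t *\<^sub>R y) (axis i 1))) (nhds 0)"
    using eventually_line_mem[OF open_K x, of y]
    by eventually_elim (rule projective_factor_expand)
  ultimately have "((\<lambda>t. P (x + t *\<^sub>R y) y) has_real_derivative
      (\<Sum>i\<in>UNIV. y $ i * (\<Sum>j\<in>UNIV. y $ j * dx j P x (axis i 1)))) (at 0)"
    by (subst DERIV_cong_ev[OF refl _ refl])
  from DERIV_unique[OF this projective_factor_derivative_along[OF x False]]
  show ?thesis by (simp add: sum_distrib_left mult.assoc)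
qed

text \<open>
  The symmetric matrix of the quadratic form on the right-hand side of \<open>hilbert_squared\<close>.
\<close>

definition hilbert_matrix :: "real ^ 'n \<Rightarrow> real ^ 'n ^ 'n" where
  "hilbert_matrix x = (\<chi> i j. (dx j P x (axis i 1) + dx i P x (axis j 1)) / 2
     - P x (axis i 1) * P x (axis j 1))"

lemma projective_factor_squared:
  assumes "x \<in> K"
  shows "(P x y)\<^sup>2 = (\<Sum>i\<in>UNIV. \<Sum>j\<in>UNIV. y $ i * y $ j * (P x (axis i 1) * P x (axis j 1)))"
  unfolding projective_factor_expand[OF assms, of y] power2_eq_square sum_product
  by (simp add: mult_ac)

lemma hilbert_matrix_form:
  assumes "x \<in> K"
  shows "y \<bullet> (hilbert_matrix x *v y) = (F x y)\<^sup>2"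
proof -
  let ?D = "\<Sum>i\<in>UNIV. \<Sum>j\<in>UNIV. y $ i * y $ j * dx j P x (axis i 1)"
  have swap: "(\<Sum>i\<in>UNIV. \<Sum>j\<in>UNIV. y $ i * y $ j * dx i P x (axis j 1)) = ?D"
    by (subst sum.swap) (simp add: mult_ac)
  have "y \<bullet> (hilbert_matrix x *v y) = (?D + (\<Sum>i\<in>UNIV. \<Sum>j\<in>UNIV. y $ i * y $ j * dx i P x (axis j 1))) / 2
      - (P x y)\<^sup>2"
    unfolding quadratic_form_sum hilbert_matrix_def projective_factor_squared[OF assms]
    by (simp add: algebra_simps add_divide_distrib sum.distrib sum_subtractf sum_divide_distrib)
  then show ?thesis unfolding swap using hilbert_squared[OF assms] by simp
qed

lemma riemannian_hilbert: "riemannian K F"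
  unfolding riemannian_def
proof
  fix x assume x: "x \<in> K"
  have "transpose (hilbert_matrix x) = hilbert_matrix x"
    by (simp add: transpose_def hilbert_matrix_def vec_eq_iff mult.commute add.commute)
  then have "positive_definite (hilbert_matrix x)"
    using hilbert_pos[OF x] by (force simp: positive_definite_def hilbert_matrix_form[OF x])
  then show "\<exists>A. positive_definite A \<and> (\<forall>u. (F x u)\<^sup>2 = u \<bullet> (A *v u))"
    by (auto simp: hilbert_matrix_form[OF x])
qed

end

section \<open>Quadratic inequalities describe ellipsoids\<close>

lemma symmetric_form_commute:
  fixes B :: "real ^ 'n ^ 'n"
  assumes "transpose B = B"
  shows "u \<bullet> (B *v v) = v \<bullet> (B *v u)"
  using dot_lmul_matrix[of u B v] transpose_matrix_vector[of B u] assms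
  by (simp add: inner_commute)

text \<open>
  Gram-Schmidt orthonormalization for the inner product given by \<open>B\<close>. Indexing by subsets of the
  index type makes the full family directly the columns of a matrix.
\<close>

lemma positive_definite_orthonormal_family:
  fixes B :: "real ^ 'n::finite ^ 'n"
  assumes B: "positive_definite B" and "finite (I :: 'n set)"
  shows "\<exists>f. \<forall>i\<in>I. \<forall>j\<in>I. f i \<bullet> (B *v f j) = (if i = j then 1 else 0)"
  using \<open>finite I\<close>
proof (induction I)
  case empty
  then show ?case by simp
next
  case (insert a I)
  then obtain f where f: "\<And>i j. i \<in> I \<Longrightarrow> j \<in> I \<Longrightarrow> f i \<bullet> (B *v f j) = (if i = j then 1 else 0)"
    by blast
  have comm: "u \<bullet> (B *v v) = v \<bullet> (B *v u)" for u v
    using B by (intro symmetric_form_commute) (simp add: positive_definite_def)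
  have "dim (span (f ` I)) < DIM(real ^ 'n)"
  proof -
    have "dim (span (f ` I)) \<le> card (f ` I)" using insert by (simp add: dim_le_card')
    also have "\<dots> \<le> card I" using insert by (simp add: card_image_le)
    also have "\<dots> < CARD('n)" using insert by (intro psubset_card_mono) auto
    finally show ?thesis by simp
  qed
  then have "span (f ` I) \<noteq> UNIV" by (metis dim_UNIV less_irrefl)
  then obtain v where v: "v \<notin> span (f ` I)" by blast
  define w where "w = v - (\<Sum>i\<in>I. (v \<bullet> (B *v f i)) *\<^sub>R f i)"
  have "(\<Sum>i\<in>I. (v \<bullet> (B *v f i)) *\<^sub>R f i) \<in> span (f ` I)"
    by (intro span_sum span_scale span_base) auto
  then have "w \<noteq> 0" using v by (auto simp: w_def)
  then have wpos: "w \<bullet> (B *v w) > 0" using B by (simp add: positive_definite_def)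
  have worth: "w \<bullet> (B *v f j) = 0" if "j \<in> I" for j
  proof -
    have "w \<bullet> (B *v f j) = v \<bullet> (B *v f j) - (\<Sum>i\<in>I. (v \<bullet> (B *v f i)) * (f i \<bullet> (B *v f j)))"
      by (simp add: w_def inner_diff_left inner_sum_left)
    also have "(\<Sum>i\<in>I. (v \<bullet> (B *v f i)) * (f i \<bullet> (B *v f j))) =
        (\<Sum>i\<in>I. if i = j then v \<bullet> (B *v f i) else 0)"
      using that by (intro sum.cong) (auto simp: f)
    also have "\<dots> = v \<bullet> (B *v f j)" using insert that by simp
    finally show ?thesis by simp
  qed
  define e where "e = (1 / sqrt (w \<bullet> (B *v w))) *\<^sub>R w"
  have e: "e \<bullet> (B *v e) = 1"
    using wpos by (simp add: e_def matrix_vector_mult_scaleR field_simps)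
  have eorth: "e \<bullet> (B *v f j) = 0" "f j \<bullet> (B *v e) = 0" if "j \<in> I" for j
    using worth[OF that] comm[of "f j" e] by (simp_all add: e_def)
  have "\<forall>i\<in>insert a I. \<forall>j\<in>insert a I. (f(a := e)) i \<bullet> (B *v (f(a := e)) j) = (if i = j then 1 else 0)"
    using insert.hyps e eorth f by auto
  then show ?case by blast
qed

lemma positive_definite_orthonormal_matrix:
  fixes B :: "real ^ 'n::finite ^ 'n"
  assumes B: "positive_definite B"
  shows "\<exists>C :: real ^ 'n ^ 'n. invertible C \<and> (\<forall>v. (C *v v) \<bullet> (B *v (C *v v)) = v \<bullet> v)"
proof -
  from positive_definite_orthonormal_family[OF B finite_class.finite_UNIV]
  obtain f where "\<forall>i\<in>UNIV. \<forall>j\<in>UNIV. f i \<bullet> (B *v f j) = (if i = (j::'n) then 1 else 0)" ..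
  then have f: "f i \<bullet> (B *v f j) = (if i = j then 1 else 0)" for i j by blast
  define C :: "real ^ 'n ^ 'n" where "C = (\<chi> i j. f j $ i)"
  have C: "C *v v = (\<Sum>j\<in>UNIV. v $ j *\<^sub>R f j)" for v
    by (simp add: C_def vec_eq_iff matrix_vector_mult_def mult.commute)
  have BC: "B *v (C *v v) = (\<Sum>j\<in>UNIV. v $ j *\<^sub>R (B *v f j))" for v
    unfolding C by (simp only: linear_sum[OF matrix_vector_mul_linear] matrix_vector_mult_scaleR)
  have form: "(C *v v) \<bullet> (B *v (C *v v)) = v \<bullet> v" for v
  proof -
    have "(C *v v) \<bullet> (B *v (C *v v)) =
        (\<Sum>i\<in>UNIV. \<Sum>j\<in>UNIV. v $ i * (v $ j * (f j \<bullet> (B *v f i))))"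
      unfolding BC unfolding C
      by (simp only: inner_sum_left inner_sum_right inner_scaleR_left inner_scaleR_right sum_distrib_left)
    also have "\<dots> = (\<Sum>i\<in>UNIV. \<Sum>j\<in>UNIV. if i = j then v $ i * v $ j else 0)"
      by (intro sum.cong refl) (simp add: f)
    also have "\<dots> = v \<bullet> v" by (simp add: inner_vec_def)
    finally show ?thesis .
  qed
  have "v = 0" if "C *v v = 0" for v
    using form[of v] that by simp
  then have "invertible C" unfolding invertible_left_inverse matrix_left_invertible_ker by blast
  with form show ?thesis by (intro exI[of _ C]) simp
qed

text \<open>
  Completing the square with \<open>B w = p\<close> gives \<open>(y + w) B (y + w) < 1 + w B w\<close>, and a \<open>B\<close>-orthonormal
  basis turns this into a Euclidean ball.
\<close>

lemma ellipsoid_quadratic: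
  fixes B :: "real ^ 'n::finite ^ 'n"
  assumes B: "positive_definite B"
    and K: "\<And>y. x + y \<in> K \<longleftrightarrow> y \<bullet> (B *v y) + 2 * (p \<bullet> y) < 1"
  shows "ellipsoid K"
proof -
  let ?Q = "\<lambda>y. y \<bullet> (B *v y)"
  obtain B' where B': "B ** B' = mat 1"
    using positive_definite_invertible[OF B] unfolding invertible_def by blast
  define w where "w = B' *v p"
  have w: "B *v w = p" using B' by (simp add: w_def matrix_vector_mul_assoc)
  have comm: "u \<bullet> (B *v v) = v \<bullet> (B *v u)" for u v
    using B by (intro symmetric_form_commute) (simp add: positive_definite_def)
  have Qw: "?Q w \<ge> 0"
  proof (cases "w = 0")
    case False
    then have "?Q w > 0" using B unfolding positive_definite_def by blast
    then show ?thesis by simp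
  qed simp
  define r where "r = sqrt (1 + ?Q w)"
  have r: "r > 0" "r\<^sup>2 = 1 + ?Q w" using Qw by (simp_all add: r_def)
  have square: "?Q (y + w) = ?Q y + 2 * (p \<bullet> y) + ?Q w" for y
    using comm[of w y] by (simp add: matrix_vector_right_distrib inner_add_left inner_add_right w inner_commute)
  obtain C :: "real ^ 'n ^ 'n" where "invertible C \<and> (\<forall>v. ?Q (C *v v) = v \<bullet> v)"
    using positive_definite_orthonormal_matrix[OF B] ..
  then have C: "invertible C" "(C *v v) \<bullet> (B *v (C *v v)) = v \<bullet> v" for v by simp_all
  obtain C' where C': "C ** C' = mat 1" "C' ** C = mat 1" using C(1) unfolding invertible_def by blast
  have mem: "z \<in> K \<longleftrightarrow> ?Q (z - x + w) < r\<^sup>2" for z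
    using K[of "z - x"] square[of "z - x"] r(2) by auto
  have image: "(r *\<^sub>R C) *v v + (x - w) \<in> K \<longleftrightarrow> v \<in> ball 0 1" for v
  proof -
    have "?Q ((r *\<^sub>R C) *v v) = r\<^sup>2 * (v \<bullet> v)"
      using C(2)[of v] by (simp add: matrix_vector_mult_scaleR power2_eq_square flip: scaleR_matrix_vector_assoc)
    then have "(r *\<^sub>R C) *v v + (x - w) \<in> K \<longleftrightarrow> r\<^sup>2 * (v \<bullet> v) < r\<^sup>2"
      using mem[of "(r *\<^sub>R C) *v v + (x - w)"] by simp
    also have "\<dots> \<longleftrightarrow> v \<bullet> v < 1" using r(1) by simp
    also have "\<dots> \<longleftrightarrow> norm v < 1" by (simp add: norm_eq_sqrt_inner)
    finally show ?thesis by simp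
  qed
  have surj: "\<exists>v. z = (r *\<^sub>R C) *v v + (x - w)" for z
  proof
    have "(r *\<^sub>R C) *v ((1 / r) *\<^sub>R (C' *v (z - x + w))) = z - x + w"
    proof -
      have "C *v (C' *v (z - x + w)) = z - x + w"
        using C'(1) by (simp only: matrix_vector_mul_assoc matrix_vector_mul_lid)
      then show ?thesis
        using r(1) by (simp add: matrix_vector_mult_scaleR flip: scaleR_matrix_vector_assoc)
    qed
    then show "z = (r *\<^sub>R C) *v ((1 / r) *\<^sub>R (C' *v (z - x + w))) + (x - w)" by simp
  qed
  have "invertible (r *\<^sub>R C)"
    using C(1) r(1) by (intro scalar_invertible) auto
  moreover have "K = (\<lambda>v. (r *\<^sub>R C) *v v + (x - w)) ` ball 0 1"
  proof (intro set_eqI iffI)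
    fix z assume "z \<in> K"
    then show "z \<in> (\<lambda>v. (r *\<^sub>R C) *v v + (x - w)) ` ball 0 1"
      using surj[of z] by (auto simp: image)
  next
    fix z assume "z \<in> (\<lambda>v. (r *\<^sub>R C) *v v + (x - w)) ` ball 0 1"
    then show "z \<in> K" by (auto simp: image)
  qed
  ultimately show ?thesis unfolding ellipsoid_def by blast
qed

context berwald_domain
begin

text \<open>
  Write \<open>\<theta>\<close> and \<open>\<theta>'\<close> for the Funk lengths of \<open>y\<close> and \<open>- y\<close>. Then
  \<open>\<theta> \<theta>' = F\<^sup>2 - P\<^sup>2\<close> is a positive definite quadratic form, \<open>\<theta> - \<theta>' = 2 P\<close> is linear,
  and the factorization \<open>\<theta> \<theta>' + \<theta> - \<theta>' - 1 = (\<theta> - 1) (\<theta>' + 1)\<close> shows that the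
  condition \<open>\<theta> < 1\<close>, which describes \<open>K\<close> seen from \<open>x\<close>, is a quadratic inequality.
\<close>

lemma ellipsoid_K:
  assumes "K \<noteq> {}"
  shows "ellipsoid K"
proof -
  obtain x where x: "x \<in> K" using assms by blast
  define p where "p = (\<chi> i. P x (axis i 1))"
  define B where "B = (\<chi> i j. hilbert_matrix x $ i $ j - p $ i * p $ j)"
  have Py: "P x y = p \<bullet> y" for y
    unfolding projective_factor_expand[OF x, of y] by (simp add: p_def inner_vec_def mult.commute)
  have "y \<bullet> (B *v y) = y \<bullet> (hilbert_matrix x *v y) - (P x y)\<^sup>2" for y
    unfolding quadratic_form_sum projective_factor_squared[OF x]
    by (simp add: B_def p_def sum_subtractf right_diff_distrib)
  then have Q: "y \<bullet> (B *v y) = funk K x y * funk K x (- y)" for y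
    unfolding hilbert_matrix_form[OF x] funk_eq[of K x y] funk_minus_eq
    by (simp add: power2_eq_square algebra_simps)
  have "transpose B = B"
    by (simp add: B_def transpose_def hilbert_matrix_def vec_eq_iff mult.commute add.commute)
  moreover have "y \<bullet> (B *v y) > 0" if "y \<noteq> 0" for y
    using funk_spec[OF x, of y] funk_spec[OF x, of "- y"] that by (simp add: Q)
  ultimately have "positive_definite B" by (simp add: positive_definite_def)
  moreover have "x + y \<in> K \<longleftrightarrow> y \<bullet> (B *v y) + 2 * (p \<bullet> y) < 1" for y
  proof -
    have nonneg: "funk K x (- y) \<ge> 0"
      using funk_spec[OF x, of "- y"] by (cases "y = 0") (auto simp: funk_def)
    have "y \<bullet> (B *v y) + 2 * (p \<bullet> y) - 1 = (funk K x y - 1) * (funk K x (- y) + 1)"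
      unfolding Q Py[symmetric] projective_factor_def by (simp add: field_simps)
    moreover have "\<dots> < 0 \<longleftrightarrow> funk K x y < 1"
      using nonneg by (simp add: mult_less_0_iff)
    ultimately show ?thesis using funk_less_1_iff[OF x, of y] by linarith
  qed
  ultimately show ?thesis by (rule ellipsoid_quadratic)
qed

end

theorem proposition4p3:
  fixes K :: "(real ^ 'n::finite) set"
  assumes "CARD('n) \<ge> 2"
    and "open K" and "bounded K" and "convex K" and "K \<noteq> {}"
    and "finsler_fundamental K (hilbert_fundamental K)"
    and "berwald_type K (hilbert_fundamental K)"
  shows "riemannian K (hilbert_fundamental K) \<and> ellipsoid K"
proof -
  interpret berwald_domain K by unfold_locales (use assms in auto)
  show ?thesis using riemannian_hilbert ellipsoid_K[OF \<open>K \<noteq> {}\<close>] by blast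
qed

end
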